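(* Let $0\le\theta\le\infty$ and let $\rho\to\theta$ (with $0<\rho<\infty$). Then $A^{\rho,\mathrm{hom}}\to A^{\mathrm{hom}}$, where $A^{\mathrm{hom}}$ is the homogenized matrix associated with $\theta$ (defined in the context).
   Context: $Y=[0,2\pi)^d$. $A(y)$ is a $d\times d$ matrix with real, bounded, measurable entries on $\mathbb{R}^d$ that is symmetric, $Y$-periodic ($A(y+2\pi p)=A(y)$ for all $p\in\mathbb{Z}^d$, a.e. $y$), and elliptic: there is $\alpha>0$ with $A(y)\xi\cdot\xi\ge\alpha|\xi|^2$ for all $\xi\in\mathbb{R}^d$, a.e. $y$. $H^s_\sharp(Y)$ is the Sobolev space of $Y$-periodic functions, identified with $H^s$ of the torus $\mathbb{R}^d/2\pi\mathbb{Z}^d$; $\mathcal{M}_Y(u)=\frac1{|Y|}\int_Yu\,dy$; $e_j$ is the $j$-th standard unit vector. For $0\le\rho<\infty$ and $1\le j\le d$, $\chi_j^\rho$ (in $H^2_\sharp(Y)$ if $\rho>0$, in $H^1_\sharp(Y)$ if $\rho=0$) is the unique $Y$-periodic solution of $\rho^2\Delta^2\chi_j^\rho-\operatorname{div}A(y)(e_j+\nabla\chi_j^\rho)=0$ in $\mathbb{R}^d$ with $\mathcal{M}_Y(\chi_j^\rho)=0$. For $0\le\rho<\infty$, $A^{\rho,\mathrm{hom}}=\mathcal{M}_Y(A+A\nabla\chi^\rho)$ is the matrix with $(k,l)$ entry $\mathcal{M}_Y(e_k\cdot Ae_l+e_k\cdot A\nabla\chi_l^\rho)$. Finally $A^{\mathrm{hom}}=\mathcal{M}_Y(A+A\nabla\chi^\theta)$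 if $0<\theta<\infty$, $A^{\mathrm{hom}}=\mathcal{M}_Y(A+A\nabla\chi^0)$ if $\theta=0$, and $A^{\mathrm{hom}}=\mathcal{M}_Y(A)$ if $\theta=\infty$. *)

theory Defs
  imports "HOL-Analysis.Analysis"
begin

type_synonym 'n scalar_field = "real ^ 'n \<Rightarrow> real"

definition Y :: "(real ^ 'n) set" where
  "Y = {y. \<forall>i. 0 \<le> y $ i \<and> y $ i < 2 * pi}"

definition mean_Y :: "('n::finite) scalar_field \<Rightarrow> real" where
  "mean_Y u = (LINT y:Y|lebesgue. u y) / measure lebesgue (Y :: (real ^ 'n) set)"

definition lattice_shift :: "int ^ 'n \<Rightarrow> real ^ 'n" where
  "lattice_shift p = (\<chi> i. 2 * pi * real_of_int (p $ i))"

definition ae_periodic :: "(real ^ ('n::finite) \<Rightarrow> 'b) \<Rightarrow> bool" where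
  "ae_periodic u \<longleftrightarrow> (\<forall>p. AE y in lebesgue. u (y + lattice_shift p) = u y)"


subsection \<open>Smooth periodic test functions\<close>

definition pd :: "'n::finite \<Rightarrow> 'n scalar_field \<Rightarrow> 'n scalar_field" where
  "pd i \<phi> = (\<lambda>y. frechet_derivative \<phi> (at y) (axis i 1))"

definition laplacian :: "('n::finite) scalar_field \<Rightarrow> 'n scalar_field" where
  "laplacian \<phi> = (\<lambda>y. \<Sum>i\<in>UNIV. pd i (pd i \<phi>) y)"

definition grad :: "('n::finite) scalar_field \<Rightarrow> real ^ 'n \<Rightarrow> real ^ 'n" where
  "grad \<phi> y = (\<chi> i. pd i \<phi> y)"

text \<open>A function is \<open>C\<^sup>\<infinity>\<close> iff every iterated partial derivative (the list records the directions)
  exists and is again Frechet differentiable at every point.\<close>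

definition smooth :: "('n::finite) scalar_field \<Rightarrow> bool" where
  "smooth \<phi> \<longleftrightarrow> (\<forall>is y. foldr pd is \<phi> differentiable (at y))"

text \<open>The space \<open>C\<^sup>\<infinity>(\<real>\<^sup>d / 2\<pi>\<int>\<^sup>d)\<close>.\<close>

definition smooth_periodic :: "('n::finite) scalar_field set" where
  "smooth_periodic = {\<phi>. smooth \<phi> \<and> (\<forall>p y. \<phi> (y + lattice_shift p) = \<phi> y)}"


subsection \<open>Periodic Sobolev spaces\<close>

text \<open>Elements of Sobolev spaces are represented by functions, not by classes modulo null sets.\<close>

definition L2_per :: "('n::finite) scalar_field set" where
  "L2_per = {u. u \<in> borel_measurable lebesgue \<and> ae_periodic u \<and>
                set_integrable lebesgue Y (\<lambda>y. (u y)\<^sup>2)}"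

text \<open>\<open>v\<close> is the \<open>i\<close>-th partial derivative of \<open>u\<close> in the sense of distributions on the torus.\<close>

definition has_weak_pd :: "'n::finite \<Rightarrow> 'n scalar_field \<Rightarrow> 'n scalar_field \<Rightarrow> bool" where
  "has_weak_pd i u v \<longleftrightarrow>
     (\<forall>\<phi>\<in>smooth_periodic. (LINT y:Y|lebesgue. u y * pd i \<phi> y) = - (LINT y:Y|lebesgue. v y * \<phi> y))"

primrec H_per :: "nat \<Rightarrow> ('n::finite) scalar_field set" where
  "H_per 0 = L2_per"
| "H_per (Suc s) = {u \<in> L2_per. \<forall>i. \<exists>v \<in> H_per s. has_weak_pd i u v}"

text \<open>The weak gradient of \<open>u \<in> H_per 1\<close>; it is determined up to null sets, and a representative is
  chosen.\<close>

definition weak_pd :: "'n::finite \<Rightarrow> 'n scalar_field \<Rightarrow> 'n scalar_field" where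
  "weak_pd i u = (SOME v. v \<in> L2_per \<and> has_weak_pd i u v)"

definition weak_grad :: "('n::finite) scalar_field \<Rightarrow> real ^ 'n \<Rightarrow> real ^ 'n" where
  "weak_grad u y = (\<chi> i. weak_pd i u y)"


subsection \<open>Coefficients, correctors and homogenized matrices\<close>

definition elliptic :: "(real ^ ('n::finite) \<Rightarrow> real ^ 'n ^ 'n) \<Rightarrow> bool" where
  "elliptic A \<longleftrightarrow> (\<exists>\<alpha>>0. AE y in lebesgue. \<forall>\<xi>. (A y *v \<xi>) \<bullet> \<xi> \<ge> \<alpha> * (norm \<xi>)\<^sup>2)"

definition admissible_coeff :: "(real ^ ('n::finite) \<Rightarrow> real ^ 'n ^ 'n) \<Rightarrow> bool" where
  "admissible_coeff A \<longleftrightarrow>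
     (\<forall>k l. (\<lambda>y. A y $ k $ l) \<in> borel_measurable lebesgue) \<and>
     (\<exists>C. AE y in lebesgue. \<forall>k l. \<bar>A y $ k $ l\<bar> \<le> C) \<and>
     (AE y in lebesgue. transpose (A y) = A y) \<and>
     ae_periodic A \<and> elliptic A"

text \<open>\<open>w\<close> solves \<open>\<rho>\<^sup>2 \<Delta>\<^sup>2 w - div A (e\<^sub>j + \<nabla>w) = 0\<close>, with mean zero. The equation is
  read in the sense of distributions on the torus: \<open>\<langle>\<Delta>\<^sup>2 w, \<phi>\<rangle> = \<integral> w \<Delta>\<^sup>2 \<phi>\<close> and
  \<open>\<langle>- div F, \<phi>\<rangle> = \<integral> F \<cdot> \<nabla>\<phi>\<close>.\<close>

definition is_corrector ::
    "(real ^ ('n::finite) \<Rightarrow> real ^ 'n ^ 'n) \<Rightarrow> real \<Rightarrow> 'n \<Rightarrow> 'n scalar_field \<Rightarrow> bool" where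
  "is_corrector A \<rho> j w \<longleftrightarrow>
     w \<in> H_per (if \<rho> > 0 then 2 else 1) \<and>
     (\<forall>\<phi>\<in>smooth_periodic.
        \<rho>\<^sup>2 * (LINT y:Y|lebesgue. w y * laplacian (laplacian \<phi>) y) +
        (LINT y:Y|lebesgue. (A y *v (axis j 1 + weak_grad w y)) \<bullet> grad \<phi> y) = 0) \<and>
     mean_Y w = 0"

text \<open>\<open>M\<^sub>Y(A + A \<nabla>w)\<close> for a family \<open>w\<close> of \<open>d\<close> functions.\<close>

definition hom_matrix ::
    "(real ^ ('n::finite) \<Rightarrow> real ^ 'n ^ 'n) \<Rightarrow> ('n \<Rightarrow> 'n scalar_field) \<Rightarrow> real ^ 'n ^ 'n" where
  "hom_matrix A w =
     (\<chi> k l. mean_Y (\<lambda>y. axis k 1 \<bullet> (A y *v axis l 1) + axis k 1 \<bullet> (A y *v weak_grad (w l) y)))"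

definition mean_matrix :: "(real ^ ('n::finite) \<Rightarrow> real ^ 'n ^ 'n) \<Rightarrow> real ^ 'n ^ 'n" where
  "mean_matrix A = (\<chi> k l. mean_Y (\<lambda>y. A y $ k $ l))"

text \<open>The homogenized matrix associated with \<open>\<theta> \<in> [0, \<infinity>]\<close>; \<open>X \<rho> j\<close> is the corrector
  \<open>\<chi>\<^sub>j\<^sup>\<rho>\<close>.\<close>

definition A_hom ::
    "(real ^ ('n::finite) \<Rightarrow> real ^ 'n ^ 'n) \<Rightarrow> (real \<Rightarrow> 'n \<Rightarrow> 'n scalar_field) \<Rightarrow> ereal \<Rightarrow> real ^ 'n ^ 'n"
  where
  "A_hom A X \<theta> = (if \<theta> = \<infinity> then mean_matrix A else hom_matrix A (X (real_of_ereal \<theta>)))"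

end

theory Submission
  imports Defs
begin

text \<open>
  Only the mean of \<open>A \<nabla>\<chi>\<^sub>l\<^sup>\<rho>\<close> depends on \<open>\<rho>\<close>, so it suffices that \<open>\<nabla>\<chi>\<^sub>l\<^sup>\<rho>\<close> converges in \<open>L\<^sup>2(Y)\<close> to
  \<open>\<nabla>\<chi>\<^sub>l\<^sup>\<theta>\<close>, or to \<open>0\<close> if \<open>\<theta> = \<infinity>\<close>. The usual way is to test the corrector equation with
  correctors, which calls for a density theorem in Sobolev spaces. Fourier series replace it.

  Let \<open>w\<close> be the corrector for the parameter \<open>r\<close>, and write \<open>u\<^sup>^(n)\<close> for the \<open>n\<close>-th Fourier
  coefficient of \<open>u\<close>, where \<open>n\<close> ranges over the integer vectors. Trigonometric test functions
  turn weak derivatives into multiplication by \<open>\<i> n\<^sub>i\<close>, and the corrector equation into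
  \<open>r\<^sup>2 \<bar>n\<bar>\<^sup>4 w\<^sup>^(n) = \<Sum>\<^sub>i \<i> n\<^sub>i F\<^sub>i\<^sup>^(n)\<close> with \<open>F = A (e\<^sub>j + \<nabla>w)\<close>. Taking the inner product with
  \<open>z\<^sup>^(n)\<close>, for any \<open>z\<close> with a weak gradient in \<open>L\<^sup>2\<close>, and summing over \<open>n\<close> by Parseval's identity
  gives \<open>\<Sum>\<^sub>n r\<^sup>2 \<bar>n\<bar>\<^sup>4 w\<^sup>^(n) \<bullet> z\<^sup>^(n) = - \<bar>Y\<bar> \<integral> A (e\<^sub>j + \<nabla>w) \<bullet> \<nabla>z\<close> (\<open>energy_identity\<close>). This is the
  equation tested with \<open>z\<close>; the left-hand side stands for \<open>r\<^sup>2 \<integral> \<Delta>w \<Delta>z\<close>, up to the factor \<open>\<bar>Y\<bar>\<close>.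
  Each of the three regimes follows from it.

  \<^item> \<open>\<theta> = \<infinity>\<close>: take \<open>z = w\<close>. As \<open>\<bar>n\<bar>\<^sup>2 \<le> \<bar>n\<bar>\<^sup>4\<close> for integer vectors, the left-hand side is at least
    \<open>r\<^sup>2 \<bar>Y\<bar> \<parallel>\<nabla>w\<parallel>\<^sup>2\<close>, while the right-hand side is at most linear in \<open>\<parallel>\<nabla>w\<parallel>\<close>. Hence \<open>\<parallel>\<nabla>w\<parallel>\<close> is
    \<open>O(r\<^sup>-\<^sup>2)\<close> (\<open>corrector_gradient_decay\<close>).
  \<^item> \<open>0 < \<theta> < \<infinity>\<close>: subtract \<open>r\<^sup>2/\<theta>\<^sup>2\<close> times the identity for \<open>\<theta>\<close> from the one for \<open>r\<close>, with \<open>z\<close> the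
    difference of the correctors. The left-hand sides combine to a nonnegative series, and
    ellipticity gives \<open>\<parallel>\<nabla>z\<parallel> \<le> C \<bar>r\<^sup>2/\<theta>\<^sup>2 - 1\<bar>\<close> (\<open>corrector_gradient_Lipschitz\<close>).
  \<^item> \<open>\<theta> = 0\<close>: again with \<open>z\<close> the difference, \<open>\<parallel>\<nabla>z\<parallel>\<^sup>2\<close> is controlled by a series that is split at a
    finite set of frequencies. Outside the set one uses that the flux \<open>F\<close> is bounded in \<open>L\<^sup>2\<close>
    uniformly in \<open>r\<close> and that the Fourier series of \<open>\<nabla>\<chi>\<^sup>0\<close> has a small tail; inside, the factor
    \<open>r\<^sup>2\<close> is small (\<open>corrector_gradient_defect\<close>, \<open>corrector_gradient_continuous_at_0\<close>). This limit
    comes without a rate, since nothing is known on how fast the tail decays.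

  Parseval's identity itself needs orthogonality of the exponentials, which follows from a
  translation of the cell, and density of trigonometric polynomials in \<open>L\<^sup>2(Y)\<close>, which follows from
  the Stone-Weierstrass theorem on the torus embedded in complex coordinate space.
\<close>

section \<open>Square integrable functions\<close>

text \<open>The target is an arbitrary Euclidean space, so that scalar functions, complex exponentials and
  gradient fields are handled at once. Functions are not identified modulo null sets.\<close>
definition L2 :: "'a measure \<Rightarrow> ('a \<Rightarrow> 'b::euclidean_space) \<Rightarrow> bool" where
  "L2 M f \<longleftrightarrow> f \<in> borel_measurable M \<and> integrable M (\<lambda>x. (norm (f x))\<^sup>2)"

definition L2_norm :: "'a measure \<Rightarrow> ('a \<Rightarrow> 'b::euclidean_space) \<Rightarrow> real" where
  "L2_norm M f = sqrt (\<integral>x. (norm (f x))\<^sup>2 \<partial>M)"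

lemma L2_measurable [measurable_dest]: "L2 M f \<Longrightarrow> f \<in> borel_measurable M"
  by (simp add: L2_def)

lemma L2_integrable_square: "L2 M f \<Longrightarrow> integrable M (\<lambda>x. (norm (f x))\<^sup>2)"
  by (simp add: L2_def)

lemma L2_norm_nonneg: "0 \<le> L2_norm M f"
  by (simp add: L2_norm_def)

lemma L2_norm_square: "(L2_norm M f)\<^sup>2 = (\<integral>x. (norm (f x))\<^sup>2 \<partial>M)"
  by (simp add: L2_norm_def)

lemma L2_dominated:
  assumes "f \<in> borel_measurable M" "L2 M g" "AE x in M. norm (f x) \<le> C * norm (g x)"
  shows "L2 M f"
  unfolding L2_def
proof
  show "integrable M (\<lambda>x. (norm (f x))\<^sup>2)"
  proof (rule Bochner_Integration.integrable_bound)
    show "integrable M (\<lambda>x. C\<^sup>2 * (norm (g x))\<^sup>2)"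
      using L2_integrable_square[OF assms(2)] by simp
    show "(\<lambda>x. (norm (f x))\<^sup>2) \<in> borel_measurable M"
      using assms(1) by measurable
    show "AE x in M. norm ((norm (f x))\<^sup>2) \<le> norm (C\<^sup>2 * (norm (g x))\<^sup>2)"
      using assms(3) by eventually_elim
        (metis norm_ge_zero power_mono power_mult_distrib real_norm_def abs_of_nonneg zero_le_power2)
  qed
qed fact

lemma L2_norm_dominated:
  assumes "L2 M f" "L2 M g" "AE x in M. norm (f x) \<le> C * norm (g x)" "0 \<le> C"
  shows "L2_norm M f \<le> C * L2_norm M g"
proof -
  have "(\<integral>x. (norm (f x))\<^sup>2 \<partial>M) \<le> (\<integral>x. C\<^sup>2 * (norm (g x))\<^sup>2 \<partial>M)"
  proof (rule integral_mono_AE)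
    show "AE x in M. (norm (f x))\<^sup>2 \<le> C\<^sup>2 * (norm (g x))\<^sup>2"
      using assms(3) by eventually_elim (metis norm_ge_zero power_mono power_mult_distrib)
  qed (use assms in \<open>simp_all add: L2_integrable_square\<close>)
  then have "(L2_norm M f)\<^sup>2 \<le> (C * L2_norm M g)\<^sup>2"
    by (simp add: L2_norm_square power_mult_distrib)
  then show ?thesis
    using assms(4) L2_norm_nonneg by (meson mult_nonneg_nonneg power2_le_imp_le)
qed

lemma L2_bounded:
  assumes "finite_measure M" "f \<in> borel_measurable M" "AE x in M. norm (f x) \<le> C"
  shows "L2 M f"
proof (rule L2_dominated)
  show "L2 M (\<lambda>_. 1::real)"
    using assms(1) by (simp add: L2_def finite_measure.integrable_const)
  show "AE x in M. norm (f x) \<le> C * norm (1::real)"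
    using assms(3) by simp
qed fact

lemma L2_integrable_inner:
  assumes "L2 M f" "L2 M g" shows "integrable M (\<lambda>x. f x \<bullet> g x)"
proof (rule Bochner_Integration.integrable_bound)
  show "integrable M (\<lambda>x. (norm (f x))\<^sup>2 + (norm (g x))\<^sup>2)"
    using assms by (simp add: L2_integrable_square)
  show "(\<lambda>x. f x \<bullet> g x) \<in> borel_measurable M"
    using assms by measurable
  have "\<bar>a \<bullet> b\<bar> \<le> (norm a)\<^sup>2 + (norm b)\<^sup>2" for a b :: 'b
  proof -
    have "2 * (norm a * norm b) \<le> (norm a)\<^sup>2 + (norm b)\<^sup>2"
      using sum_squares_bound[of "norm a" "norm b"] by (simp add: mult.assoc)
    moreover have "0 \<le> norm a * norm b" by simp
    ultimately show ?thesis using Cauchy_Schwarz_ineq2[of a b] by linarith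
  qed
  then show "AE x in M. norm (f x \<bullet> g x) \<le> norm ((norm (f x))\<^sup>2 + (norm (g x))\<^sup>2)"
    by (auto intro: order_trans)
qed

lemma L2_scaleR: "L2 M f \<Longrightarrow> L2 M (\<lambda>x. c *\<^sub>R f x)"
  by (rule L2_dominated[where g = f and C = "\<bar>c\<bar>"]) auto

lemma L2_add:
  assumes "L2 M f" "L2 M g" shows "L2 M (\<lambda>x. f x + g x)"
  unfolding L2_def
proof
  have "(norm (f x + g x))\<^sup>2 = (norm (f x))\<^sup>2 + (norm (g x))\<^sup>2 + 2 * (f x \<bullet> g x)" for x
    by (simp add: power2_norm_eq_inner inner_add inner_commute)
  then show "integrable M (\<lambda>x. (norm (f x + g x))\<^sup>2)"
    using assms by (simp add: L2_integrable_inner L2_integrable_square)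
qed (use assms in measurable)

lemma L2_diff: "L2 M f \<Longrightarrow> L2 M g \<Longrightarrow> L2 M (\<lambda>x. f x - g x)"
  using L2_add[of M f "\<lambda>x. (-1) *\<^sub>R g x"] L2_scaleR[of M g "-1"] by simp

text \<open>The quadratic polynomial \<open>s \<mapsto> \<integral> \<bar>f - s g\<bar>\<^sup>2\<close> is nonnegative, which bounds its discriminant.\<close>
lemma L2_Cauchy_Schwarz:
  assumes "L2 M f" "L2 M g"
  shows "\<bar>\<integral>x. f x \<bullet> g x \<partial>M\<bar> \<le> L2_norm M f * L2_norm M g"
proof -
  define p where "p = (\<integral>x. f x \<bullet> g x \<partial>M)"
  define a where "a = (L2_norm M f)\<^sup>2"
  define b where "b = (L2_norm M g)\<^sup>2"
  have quad: "0 \<le> a - 2 * s * p + s\<^sup>2 * b" for s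
  proof -
    have "0 \<le> (\<integral>x. (norm (f x - s *\<^sub>R g x))\<^sup>2 \<partial>M)" by simp
    also have "\<dots> = (\<integral>x. (norm (f x))\<^sup>2 - 2 * s * (f x \<bullet> g x) + s\<^sup>2 * (norm (g x))\<^sup>2 \<partial>M)"
    proof (rule Bochner_Integration.integral_cong)
      show "(norm (f x - s *\<^sub>R g x))\<^sup>2 = (norm (f x))\<^sup>2 - 2 * s * (f x \<bullet> g x) + s\<^sup>2 * (norm (g x))\<^sup>2" for x
        by (simp only: power2_norm_eq_inner)
          (simp add: inner_diff_left inner_diff_right inner_commute algebra_simps power2_eq_square)
    qed simp
    also have "\<dots> = a - 2 * s * p + s\<^sup>2 * b"
      using assms by (simp add: a_def b_def p_def L2_norm_square L2_integrable_inner L2_integrable_square)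
    finally show ?thesis .
  qed
  have "p\<^sup>2 \<le> a * b"
  proof (cases "b = 0")
    case True
    \<comment> \<open>If the leading coefficient vanishes, the polynomial is affine, hence constant.\<close>
    have "p = 0"
    proof (rule ccontr)
      assume "p \<noteq> 0"
      then have "2 * ((a + 1) / (2 * p)) * p = a + 1" by simp
      then show False using quad[of "(a + 1) / (2 * p)"] True by simp
    qed
    then show ?thesis using True by simp
  next
    case False
    then have "b > 0" by (simp add: b_def)
    have "a - 2 * (p / b) * p + (p / b)\<^sup>2 * b = a - p\<^sup>2 / b"
      using False by (simp add: field_simps power2_eq_square)
    then have "p\<^sup>2 / b \<le> a" using quad[of "p / b"] by simp
    then show ?thesis using \<open>b > 0\<close> by (simp add: field_simps)
  qed
  then have "\<bar>p\<bar>\<^sup>2 \<le> (L2_norm M f * L2_norm M g)\<^sup>2"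
    by (simp add: a_def b_def power_mult_distrib)
  then show ?thesis
    unfolding p_def by (rule power2_le_imp_le) (simp add: L2_norm_nonneg)
qed

lemma L2_component: "L2 M v \<Longrightarrow> L2 M (\<lambda>x. v x $ i)"
  for v :: "'a \<Rightarrow> real ^ 'n"
proof (rule L2_dominated[where g = v and C = 1])
  assume "L2 M v"
  then show "(\<lambda>x. v x $ i) \<in> borel_measurable M"
    using borel_measurable_inner[OF L2_measurable[of M v] borel_measurable_const[of "axis i 1"]]
    by (simp add: inner_axis)
qed (auto simp: component_le_norm_cart)

lemma measurable_vec_lambda:
  fixes f :: "'n::finite \<Rightarrow> 'a \<Rightarrow> 'b::euclidean_space"
  assumes "\<And>i. f i \<in> borel_measurable M"
  shows "(\<lambda>x. \<chi> i. f i x) \<in> borel_measurable M"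
proof (subst borel_measurable_euclidean_space, intro ballI)
  fix b :: "'b ^ 'n" assume "b \<in> Basis"
  then obtain i u where "b = axis i u" by (auto simp: Basis_vec_def)
  then show "(\<lambda>x. (\<chi> i. f i x) \<bullet> b) \<in> borel_measurable M"
    using assms[of i] by (simp add: inner_axis)
qed

lemma L2_vec_lambda:
  fixes f :: "'n::finite \<Rightarrow> 'a \<Rightarrow> real"
  assumes "\<And>i. L2 M (f i)"
  shows "L2 M (\<lambda>x. \<chi> i. f i x)"
  unfolding L2_def
proof
  show "(\<lambda>x. \<chi> i. f i x) \<in> borel_measurable M"
    by (intro measurable_vec_lambda L2_measurable assms)
  have "(norm (\<chi> i. f i x))\<^sup>2 = (\<Sum>i\<in>UNIV. (norm (f i x))\<^sup>2)" for x
    unfolding power2_norm_eq_inner by (simp add: inner_vec_def)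
  then show "integrable M (\<lambda>x. (norm (\<chi> i. f i x))\<^sup>2)"
    using L2_integrable_square[OF assms] by simp
qed

section \<open>The periodicity cell\<close>

abbreviation cell :: "(real ^ 'n::finite) measure" where "cell \<equiv> lebesgue_on Y"

abbreviation vol :: "'n::finite itself \<Rightarrow> real" where "vol _ \<equiv> measure lebesgue (Y :: (real ^ 'n) set)"

lemma Y_borel [measurable]: "(Y :: (real ^ 'n::finite) set) \<in> sets borel"
proof -
  have "Y = (\<Inter>i. {y :: real ^ 'n. 0 \<le> y $ i} \<inter> {y. y $ i < 2 * pi})"
    by (auto simp: Y_def)
  moreover have "{y :: real ^ 'n. 0 \<le> y $ i} \<inter> {y. y $ i < 2 * pi} \<in> sets borel" for i
    by (intro sets.Int borel_closed borel_open closed_halfspace_component_ge_cart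
        open_halfspace_component_lt_cart)
  ultimately show ?thesis
    by (metis (no_types, lifting) UNIV_not_empty finite sets.finite_INT)
qed

lemma Y_lebesgue [measurable, simp]: "(Y :: (real ^ 'n::finite) set) \<in> sets lebesgue"
  by (metis Y_borel sets_completionI_sets sets_lborel)

lemma box_subset_Y: "box 0 (\<chi> i. 2 * pi) \<subseteq> (Y :: (real ^ 'n::finite) set)"
  by (auto simp: Y_def mem_box_cart less_imp_le)

lemma Y_subset_cbox: "(Y :: (real ^ 'n::finite) set) \<subseteq> cbox 0 (\<chi> i. 2 * pi)"
  by (auto simp: Y_def mem_box_cart less_imp_le)

lemma bounded_Y: "bounded (Y :: (real ^ 'n::finite) set)"
  using Y_subset_cbox bounded_cbox bounded_subset by blast

lemma Y_lmeasurable: "(Y :: (real ^ 'n::finite) set) \<in> lmeasurable"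
  using bounded_Y bounded_set_imp_lmeasurable Y_lebesgue by blast

lemma finite_measure_cell: "finite_measure (cell :: (real ^ 'n::finite) measure)"
  using Y_lmeasurable finite_measure_lebesgue_on by blast

lemma vol_pos: "vol TYPE('n::finite) > 0"
proof -
  have "\<not> negligible (box 0 (\<chi> i. 2 * pi) :: (real ^ 'n) set)"
    by (simp add: negligible_interval interval_ne_empty_cart)
  then have "\<not> negligible (Y :: (real ^ 'n) set)"
    using box_subset_Y negligible_subset by blast
  then show ?thesis
    using Y_lmeasurable negligible_iff_measure by (metis less_eq_real_def measure_nonneg)
qed

lemma set_integral_cell: "(LINT y:Y|lebesgue. f y) = (\<integral>y. f y \<partial>cell)"
  for f :: "real ^ 'n::finite \<Rightarrow> real"
  by (simp add: set_lebesgue_integral_def integral_restrict_space)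

lemma mean_Y_cell: "mean_Y f = (\<integral>y. f y \<partial>cell) / vol TYPE('n)" for f :: "real ^ 'n::finite \<Rightarrow> real"
  by (simp add: mean_Y_def set_integral_cell)

lemma L2_cellI: "u \<in> L2_per \<Longrightarrow> L2 cell u"
  by (auto simp: L2_per_def L2_def set_integrable_def integrable_restrict_space measurable_restrict_space1)

lemma AE_cell: "AE y in lebesgue. P y \<Longrightarrow> AE y in cell. P y"
  for P :: "real ^ 'n::finite \<Rightarrow> bool"
  by (subst AE_restrict_space_iff) auto

section \<open>Exponentials and their orthogonality\<close>

definition freq :: "int ^ 'n \<Rightarrow> real ^ 'n" where "freq n = (\<chi> i. real_of_int (n $ i))"

definition wave :: "int ^ 'n::finite \<Rightarrow> real ^ 'n \<Rightarrow> complex" where "wave n y = cis (freq n \<bullet> y)"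

lemma freq_add: "freq (m + n) = freq m + freq n"
  by (simp add: freq_def vec_eq_iff)

lemma freq_minus: "freq (- n) = - freq n"
  by (simp add: freq_def vec_eq_iff)

lemma freq_nth [simp]: "freq n $ i = real_of_int (n $ i)"
  by (simp add: freq_def)

lemma wave_mult: "wave m y * wave n y = wave (m + n) y"
  by (simp add: wave_def freq_add inner_add_left cis_mult)

lemma wave_zero: "wave 0 y = 1" for y :: "real ^ 'n::finite"
proof -
  have "freq (0 :: int ^ 'n) = 0" by (simp add: freq_def vec_eq_iff)
  then show ?thesis by (simp add: wave_def)
qed

lemma cnj_wave: "cnj (wave n y) = wave (- n) y"
  by (simp add: wave_def freq_minus cis_cnj)

lemma norm_wave [simp]: "norm (wave n y) = 1"
  by (simp add: wave_def)

lemma continuous_wave: "continuous_on S (wave n)"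
  unfolding wave_def cis.code Complex_eq by (intro continuous_intros)

lemma borel_measurable_wave [measurable]: "wave n \<in> borel_measurable borel"
  by (intro borel_measurable_continuous_onI continuous_wave)

lemma borel_measurable_wave_cell [measurable]: "wave n \<in> borel_measurable cell"
  by (intro measurable_restrict_space1 measurable_completion) simp

lemma integral_lborel_translate:
  fixes f :: "'a::euclidean_space \<Rightarrow> 'b::{banach, second_countable_topology}"
  assumes [measurable]: "f \<in> borel_measurable borel"
  shows "(\<integral>y. f (y + a) \<partial>lborel) = (\<integral>y. f y \<partial>lborel)"
proof -
  have "(\<integral>y. f y \<partial>lborel) = (\<integral>y. f y \<partial>distr lborel borel ((+) a))"
    by (simp add: lborel_distr_plus)
  also have "\<dots> = (\<integral>y. f (y + a) \<partial>lborel)"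
    by (subst integral_distr) (auto simp: add.commute)
  finally show ?thesis by simp
qed

lemma integrable_indicator_wave:
  assumes "B \<in> sets borel" "bounded B"
  shows "integrable lborel (\<lambda>y. indicator B y *\<^sub>R wave n y)"
proof (rule Bochner_Integration.integrable_bound)
  show "integrable lborel (indicator B :: _ \<Rightarrow> real)"
    using assms emeasure_bounded_finite[of B] by (simp add: integrable_indicator_iff)
  show "(\<lambda>y. indicator B y *\<^sub>R wave n y) \<in> borel_measurable lborel"
    using assms(1) by measurable
qed simp

text \<open>Translation by \<open>\<pi>/\<bar>n\<^sub>i\<bar>\<close> in a direction \<open>i\<close> with \<open>n\<^sub>i \<noteq> 0\<close> changes the sign of the exponential,
  whereas the integral of a periodic function over the cell is invariant under translations.\<close>
lemma integral_wave_eq_0: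
  fixes n :: "int ^ 'n::finite"
  assumes "n \<noteq> 0"
  shows "(\<integral>y. wave n y \<partial>cell) = 0"
proof -
  obtain i where i: "n $ i \<noteq> 0" using assms by (auto simp: vec_eq_iff)
  define s where "s = pi / \<bar>real_of_int (n $ i)\<bar>"
  define a :: "real ^ 'n" where "a = axis i s"
  define b :: "real ^ 'n" where "b = axis i (2 * pi)"
  have "\<bar>real_of_int (n $ i)\<bar> \<ge> 1" using i by linarith
  then have s: "0 < s" "s \<le> pi" by (auto simp: s_def field_simps)
  have "real_of_int (n $ i) * s = pi \<or> real_of_int (n $ i) * s = - pi"
    using i by (auto simp: s_def abs_if)
  then have "cis (freq n \<bullet> a) = -1"
    by (auto simp: a_def inner_axis complex_eq_iff)
  then have wa: "wave n (y + a) = - wave n y" for y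
    by (simp add: wave_def inner_add_right flip: cis_mult)
  have "freq n \<bullet> b = 2 * pi * real_of_int (n $ i)"
    by (simp add: b_def inner_axis)
  then have "cis (freq n \<bullet> b) = 1"
    by (simp only: cis_multiple_2pi Ints_of_int)
  then have wb: "wave n (y + b) = wave n y" for y
    by (simp add: wave_def inner_add_right flip: cis_mult)
  \<comment> \<open>The translated cell is \<open>B1 \<union> B2\<close>, the cell is \<open>B2 \<union> B3\<close>, and \<open>B3\<close> is \<open>B1\<close> translated by a
    period.\<close>
  define B1 where "B1 = {y. y + a \<in> Y \<and> y $ i < 0}"
  define B2 where "B2 = {y. y + a \<in> Y \<and> 0 \<le> y $ i}"
  define B3 where "B3 = {y. y \<in> Y \<and> 2 * pi - s \<le> y $ i}"
  have [measurable]: "{y :: real ^ 'n. c \<le> y $ i} \<in> sets borel" for c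
    by (intro borel_closed closed_halfspace_component_ge_cart)
  have [measurable]: "{y :: real ^ 'n. y $ i < c} \<in> sets borel" for c
    by (intro borel_open open_halfspace_component_lt_cart)
  have Ya: "(\<lambda>y. y + a) -` Y \<in> sets borel"
    using measurable_sets[of "\<lambda>y. y + a" borel borel Y] by simp
  have "B1 = (\<lambda>y. y + a) -` Y \<inter> {y. y $ i < 0}" "B2 = (\<lambda>y. y + a) -` Y \<inter> {y. 0 \<le> y $ i}"
    "B3 = Y \<inter> {y. 2 * pi - s \<le> y $ i}"
    by (auto simp: B1_def B2_def B3_def)
  then have B [measurable]: "B1 \<in> sets borel" "B2 \<in> sets borel" "B3 \<in> sets borel"
    using Ya by auto
  have coord: "axis i t $ k = (if k = i then t else 0)" for t :: real and k
    by (simp add: axis_def)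
  have "- 2 * pi \<le> y $ k \<and> y $ k \<le> 2 * pi" if "y + a \<in> Y" for y k
  proof -
    have "0 \<le> (y + a) $ k \<and> (y + a) $ k < 2 * pi" using that by (simp add: Y_def)
    moreover have "0 \<le> a $ k \<and> a $ k \<le> pi" using s by (simp add: a_def axis_def)
    ultimately show ?thesis by simp
  qed
  then have "B1 \<subseteq> cbox (\<chi> i. - 2 * pi) (\<chi> i. 2 * pi)" "B2 \<subseteq> cbox (\<chi> i. - 2 * pi) (\<chi> i. 2 * pi)"
    by (auto simp: B1_def B2_def mem_box_cart)
  then have "bounded B1" "bounded B2" "bounded B3"
    using bounded_subset[OF bounded_cbox] bounded_subset[OF bounded_Y]
    by (metis, metis, metis (lifting) B3_def mem_Collect_eq subsetI)
  then have int: "integrable lborel (\<lambda>y. indicator B y *\<^sub>R wave n y)" if "B = B1 \<or> B = B2 \<or> B = B3" for B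
    using that B \<open>bounded B1\<close> \<open>bounded B2\<close> \<open>bounded B3\<close> integrable_indicator_wave by blast
  define I where "I B = (\<integral>y. indicator B y *\<^sub>R wave n y \<partial>lborel)" for B
  have in_Y: "y \<in> Y \<longleftrightarrow> (0 \<le> y $ i \<and> y $ i < 2 * pi) \<and> (\<forall>k. k \<noteq> i \<longrightarrow> 0 \<le> y $ k \<and> y $ k < 2 * pi)"
    for y :: "real ^ 'n"
    unfolding Y_def by auto
  have Y23: "indicator Y y = (indicator B2 y + indicator B3 y :: real)" for y
    using s by (auto simp: indicator_def B2_def B3_def in_Y a_def coord)
  have Y12: "indicator Y (y + a) = (indicator B1 y + indicator B2 y :: real)" for y
    by (auto simp: indicator_def B1_def B2_def)
  have B13: "indicator B1 y = (indicator B3 (y + b) :: real)" for y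
    using s by (auto simp: indicator_def B1_def B3_def in_Y a_def b_def coord)
  have "I Y = (\<integral>y. indicator Y (y + a) *\<^sub>R wave n (y + a) \<partial>lborel)"
    unfolding I_def by (rule integral_lborel_translate[symmetric]) measurable
  also have "\<dots> = - (I B1 + I B2)"
    using int by (simp add: wa Y12 scaleR_add_left I_def)
  also have "I B1 = (\<integral>y. indicator B3 (y + b) *\<^sub>R wave n (y + b) \<partial>lborel)"
    by (simp add: I_def B13 wb)
  also have "\<dots> = I B3"
    unfolding I_def by (rule integral_lborel_translate) measurable
  also have "I B3 + I B2 = I Y"
    using int by (simp add: Y23 scaleR_add_left I_def)
  finally have "I Y = 0" by simp
  moreover have "(\<integral>y. wave n y \<partial>cell) = I Y"
    unfolding I_def by (simp add: integral_restrict_space integral_completion)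
  ultimately show ?thesis by simp
qed

lemma integral_cell_const: "(\<integral>y. c \<partial>(cell :: (real ^ 'n::finite) measure)) = vol TYPE('n) *\<^sub>R c"
  for c :: "'b::{banach, second_countable_topology}"
  by (simp add: measure_restrict_space space_restrict_space)

lemma integral_wave_cnj_wave:
  fixes m n :: "int ^ 'n::finite"
  shows "(\<integral>y. wave m y * cnj (wave n y) \<partial>cell) = (if m = n then of_real (vol TYPE('n)) else 0)"
proof (cases "m = n")
  case True
  then show ?thesis
    by (simp add: cnj_wave wave_mult wave_zero measure_restrict_space space_restrict_space scaleR_conv_of_real)
next
  case False
  then show ?thesis
    using integral_wave_eq_0[of "m - n"] by (simp add: cnj_wave wave_mult)
qed

section \<open>Density of trigonometric polynomials\<close>

inductive trigpoly :: "(real ^ 'n::finite \<Rightarrow> complex) \<Rightarrow> bool" where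
  trigpoly_wave: "trigpoly (\<lambda>y. d * wave n y)"
| trigpoly_add: "trigpoly f \<Longrightarrow> trigpoly g \<Longrightarrow> trigpoly (\<lambda>y. f y + g y)"

lemma trigpoly_const: "trigpoly (\<lambda>y. c)"
  using trigpoly_wave[of c 0] by (simp add: wave_zero)

lemma trigpoly_mult:
  assumes "trigpoly f" "trigpoly g" shows "trigpoly (\<lambda>y. f y * g y)"
  using assms(1)
proof induction
  case (trigpoly_wave c m)
  from assms(2) show ?case
  proof induction
    case (trigpoly_wave d n)
    have "(\<lambda>y. c * wave m y * (d * wave n y)) = (\<lambda>y. (c * d) * wave (m + n) y)"
      by (simp add: wave_mult[symmetric] mult_ac)
    then show ?case using trigpoly.trigpoly_wave by metis
  next
    case (trigpoly_add f g)
    then show ?case using trigpoly.trigpoly_add by (force simp: distrib_left)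
  qed
next
  case (trigpoly_add f h)
  then show ?case using trigpoly.trigpoly_add by (force simp: distrib_right)
qed

lemma trigpoly_sum: "finite I \<Longrightarrow> (\<And>i. i \<in> I \<Longrightarrow> trigpoly (f i)) \<Longrightarrow> trigpoly (\<lambda>y. \<Sum>i\<in>I. f i y)"
  by (induction I rule: finite_induct) (auto intro: trigpoly_const[of 0] trigpoly_add)

lemma trigpoly_finite_sum:
  assumes "trigpoly f"
  obtains F d where "finite F" "f = (\<lambda>y. \<Sum>n\<in>F. d n * wave n y)"
proof -
  have "\<exists>F d. finite F \<and> f = (\<lambda>y. \<Sum>n\<in>F. d n * wave n y)"
    using assms
  proof induction
    case (trigpoly_wave d n)
    show ?case by (rule exI[of _ "{n}"], rule exI[of _ "\<lambda>_. d"]) simp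
  next
    case (trigpoly_add f g)
    then obtain F d G e where F: "finite F" "f = (\<lambda>y. \<Sum>n\<in>F. d n * wave n y)"
      and G: "finite G" "g = (\<lambda>y. \<Sum>n\<in>G. e n * wave n y)" by blast
    have "f y = (\<Sum>n\<in>F \<union> G. (if n \<in> F then d n else 0) * wave n y)" for y
      using F G by (auto intro!: sum.mono_neutral_cong_left)
    moreover have "g y = (\<Sum>n\<in>F \<union> G. (if n \<in> G then e n else 0) * wave n y)" for y
      using F G by (auto intro!: sum.mono_neutral_cong_left)
    ultimately have "(\<lambda>y. f y + g y) = (\<lambda>y. \<Sum>n\<in>F \<union> G. ((if n \<in> F then d n else 0) + (if n \<in> G then e n else 0)) * wave n y)"
      by (simp add: distrib_right sum.distrib)
    then show ?case using F G
      by (intro exI[of _ "F \<union> G"] exI[of _ "\<lambda>n. (if n \<in> F then d n else 0) + (if n \<in> G then e n else 0)"]) simp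
  qed
  then show ?thesis using that by blast
qed

lemma trigpoly_L2: assumes "trigpoly f" shows "L2 cell f"
  using assms
proof induction
  case (trigpoly_wave d n)
  show ?case
    by (rule L2_bounded[where C = "norm d"]) (auto simp: finite_measure_cell norm_mult)
qed (rule L2_add)

text \<open>The cell as a subset of a complex coordinate space: real polynomials in the real and imaginary
  parts of \<open>torus y\<close> are trigonometric polynomials in \<open>y\<close>, which is what makes the
  Stone-Weierstrass theorem for polynomials applicable.\<close>
definition torus :: "real ^ 'n \<Rightarrow> complex ^ 'n" where "torus y = (\<chi> i. cis (y $ i))"

lemma continuous_torus: "continuous_on S (torus :: real ^ 'n::finite \<Rightarrow> _)"
  unfolding torus_def cis.code Complex_eq by (intro continuous_intros)

lemma inj_on_torus: "inj_on torus (Y :: (real ^ 'n::finite) set)"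
proof (rule inj_onI)
  fix x y :: "real ^ 'n" assume x: "x \<in> Y" and y: "y \<in> Y" and eq: "torus x = torus y"
  show "x = y"
  proof (subst vec_eq_iff, intro allI)
    fix i
    have "cis (x $ i) = cis (y $ i)" using eq by (simp add: torus_def vec_eq_iff)
    then obtain k :: int where k: "x $ i = y $ i + 2 * pi * k"
      using sin_cos_eq_iff[of "x $ i" "y $ i"] by (auto simp: complex_eq_iff)
    have b: "0 \<le> x $ i" "x $ i < 2 * pi" "0 \<le> y $ i" "y $ i < 2 * pi"
      using x y by (auto simp: Y_def)
    have "2 * pi * k < 2 * pi * 1" "2 * pi * (-1) < 2 * pi * k" using k b by linarith+
    then have "real_of_int k < 1" "- 1 < real_of_int k"
      by (simp_all only: mult_less_cancel_left_pos pi_gt_zero zero_less_mult_iff zero_less_numeral simp_thms)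
    then have "k = 0" by linarith
    then show "x $ i = y $ i" using k by simp
  qed
qed

text \<open>A linear function of \<open>torus y\<close> is a linear combination of cosines and sines of the coordinates,
  and trigonometric polynomials form an algebra.\<close>
lemma trigpoly_real_polynomial:
  assumes "real_polynomial_function p"
  shows "trigpoly (\<lambda>y. of_real (p (torus y)))"
  using assms
proof induction
  case (linear f)
  then interpret f: bounded_linear f .
  have tor: "torus y = (\<Sum>i\<in>UNIV. cos (y $ i) *\<^sub>R axis i 1 + sin (y $ i) *\<^sub>R axis i \<i>)" for y :: "real ^ 'n"
  proof -
    have "(\<Sum>i\<in>UNIV. cos (y $ i) *\<^sub>R axis i 1 + sin (y $ i) *\<^sub>R axis i \<i>) $ k = cis (y $ k)" for k
    proof -
      have "(\<Sum>i\<in>UNIV. cos (y $ i) *\<^sub>R axis i 1 + sin (y $ i) *\<^sub>R axis i \<i>) $ k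
        = (\<Sum>i\<in>UNIV. if i = k then cis (y $ k) else 0)"
        unfolding sum_component
        by (rule sum.cong) (auto simp: axis_def complex_eq_iff)
      then show ?thesis by simp
    qed
    then show ?thesis by (simp add: torus_def vec_eq_iff)
  qed
  have wv: "wave (axis i 1) y = cis (y $ i)" "wave (- axis i 1) y = cis (- (y $ i))" for i and y :: "real ^ 'n"
  proof -
    have "freq (axis i 1 :: int ^ 'n) = axis i 1" by (auto simp: freq_def vec_eq_iff axis_def)
    then show "wave (axis i 1) y = cis (y $ i)" "wave (- axis i 1) y = cis (- (y $ i))"
      by (simp_all add: wave_def freq_minus inner_axis')
  qed
  have "of_real (f (torus y)) = (\<Sum>i\<in>UNIV.
      ((of_real (f (axis i 1)) / 2 + of_real (f (axis i \<i>)) / (2 * \<i>)) * wave (axis i 1) y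
      + (of_real (f (axis i 1)) / 2 - of_real (f (axis i \<i>)) / (2 * \<i>)) * wave (- axis i 1) y))" for y
    unfolding wv
    unfolding tor f.sum f.add f.scaleR of_real_sum
    by (rule sum.cong[OF refl]) (simp add: complex_eq_iff)
  then show ?case
    by (simp only:) (intro trigpoly_sum trigpoly_add trigpoly_wave; simp)
next
  case (const c)
  show ?case by (rule trigpoly_const)
next
  case (add f g)
  then show ?case using trigpoly_add by force
next
  case (mult f g)
  then show ?case using trigpoly_mult by force
qed

definition trig_approximable :: "(real ^ 'n::finite \<Rightarrow> real) \<Rightarrow> bool" where
  "trig_approximable u \<longleftrightarrow>
     (\<forall>\<epsilon>>0. \<exists>f. trigpoly f \<and> (\<integral>y. (norm (of_real (u y) - f y))\<^sup>2 \<partial>cell) < \<epsilon>)"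

lemma trig_approximableE:
  assumes "trig_approximable u" "\<epsilon> > 0"
  obtains f where "trigpoly f" "(\<integral>y. (norm (of_real (u y) - f y))\<^sup>2 \<partial>cell) < \<epsilon>"
  using assms unfolding trig_approximable_def by blast

lemma L2_integral_norm_add_le:
  assumes "L2 M f" "L2 M g"
  shows "(\<integral>x. (norm (f x + g x))\<^sup>2 \<partial>M) \<le> 2 * (\<integral>x. (norm (f x))\<^sup>2 \<partial>M) + 2 * (\<integral>x. (norm (g x))\<^sup>2 \<partial>M)"
proof -
  have "(norm (a + b))\<^sup>2 \<le> 2 * (norm a)\<^sup>2 + 2 * (norm b)\<^sup>2" for a b :: 'b
    using zero_le_power2[of "norm (a - b)"]
    unfolding power2_norm_eq_inner by (simp add: inner_add inner_diff inner_commute)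
  then have "(\<integral>x. (norm (f x + g x))\<^sup>2 \<partial>M) \<le> (\<integral>x. 2 * (norm (f x))\<^sup>2 + 2 * (norm (g x))\<^sup>2 \<partial>M)"
    using assms by (intro integral_mono L2_integrable_square L2_add) (auto simp: L2_integrable_square)
  then show ?thesis using assms by (simp add: L2_integrable_square)
qed

lemma L2_of_real: "L2 M u \<Longrightarrow> L2 M (\<lambda>x. complex_of_real (u x))"
  by (rule L2_dominated[where g = u and C = 1]) (auto intro: L2_measurable)

lemma trig_approximable_add:
  assumes u: "L2 cell u" "trig_approximable u" and v: "L2 cell v" "trig_approximable v"
  shows "trig_approximable (\<lambda>y. u y + v y)"
  unfolding trig_approximable_def
proof (intro allI impI)
  fix \<epsilon> :: real assume "\<epsilon> > 0"
  then have e: "\<epsilon> / 4 > 0" by simp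
  obtain f where f: "trigpoly f" "(\<integral>y. (norm (of_real (u y) - f y))\<^sup>2 \<partial>cell) < \<epsilon> / 4"
    using u(2) e by (rule trig_approximableE)
  obtain g where g: "trigpoly g" "(\<integral>y. (norm (of_real (v y) - g y))\<^sup>2 \<partial>cell) < \<epsilon> / 4"
    using v(2) e by (rule trig_approximableE)
  have "(\<integral>y. (norm (of_real (u y + v y) - (f y + g y)))\<^sup>2 \<partial>cell)
    = (\<integral>y. (norm ((of_real (u y) - f y) + (of_real (v y) - g y)))\<^sup>2 \<partial>cell)"
    by (simp add: algebra_simps)
  also have "\<dots> \<le> 2 * (\<integral>y. (norm (of_real (u y) - f y))\<^sup>2 \<partial>cell) + 2 * (\<integral>y. (norm (of_real (v y) - g y))\<^sup>2 \<partial>cell)"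
    by (intro L2_integral_norm_add_le L2_diff L2_of_real trigpoly_L2 u v f g)
  also have "\<dots> < \<epsilon>" using f g by simp
  finally show "\<exists>h. trigpoly h \<and> (\<integral>y. (norm (of_real (u y + v y) - h y))\<^sup>2 \<partial>cell) < \<epsilon>"
    using trigpoly_add[OF f(1) g(1)] by blast
qed

lemma trig_approximable_cmult:
  assumes "trig_approximable u" shows "trig_approximable (\<lambda>y. c * u y)"
  unfolding trig_approximable_def
proof (intro allI impI)
  fix \<epsilon> :: real assume e: "\<epsilon> > 0"
  have "c\<^sup>2 + 1 > 0" by (simp add: add_nonneg_pos)
  then obtain f where f: "trigpoly f" "(\<integral>y. (norm (of_real (u y) - f y))\<^sup>2 \<partial>cell) < \<epsilon> / (c\<^sup>2 + 1)"
    using trig_approximableE[OF assms divide_pos_pos[OF e]] by blast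
  have "(\<integral>y. (norm (of_real (c * u y) - of_real c * f y))\<^sup>2 \<partial>cell)
    = c\<^sup>2 * (\<integral>y. (norm (of_real (u y) - f y))\<^sup>2 \<partial>cell)"
    by (simp add: norm_mult power_mult_distrib flip: right_diff_distrib)
  also have "\<dots> \<le> (c\<^sup>2 + 1) * (\<integral>y. (norm (of_real (u y) - f y))\<^sup>2 \<partial>cell)"
    by (intro mult_right_mono) auto
  also have "\<dots> < \<epsilon>" using f \<open>c\<^sup>2 + 1 > 0\<close> by (simp add: field_simps)
  finally show "\<exists>h. trigpoly h \<and> (\<integral>y. (norm (of_real (c * u y) - h y))\<^sup>2 \<partial>cell) < \<epsilon>"
    using trigpoly_mult[OF trigpoly_const f(1)] by blast
qed

lemma trig_approximable_closed:
  assumes u: "L2 cell u"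
    and v: "\<And>\<epsilon>. \<epsilon> > 0 \<Longrightarrow> \<exists>v. L2 cell v \<and> trig_approximable v \<and> (\<integral>y. (u y - v y)\<^sup>2 \<partial>cell) < \<epsilon>"
  shows "trig_approximable u"
  unfolding trig_approximable_def
proof (intro allI impI)
  fix \<epsilon> :: real assume "\<epsilon> > 0"
  then have e: "\<epsilon> / 4 > 0" by simp
  then obtain v where v: "L2 cell v" "trig_approximable v" "(\<integral>y. (u y - v y)\<^sup>2 \<partial>cell) < \<epsilon> / 4"
    using v by blast
  obtain f where f: "trigpoly f" "(\<integral>y. (norm (of_real (v y) - f y))\<^sup>2 \<partial>cell) < \<epsilon> / 4"
    using trig_approximableE[OF v(2) e] by blast
  have "(\<integral>y. (norm (of_real (u y) - f y))\<^sup>2 \<partial>cell)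
    = (\<integral>y. (norm (of_real (u y - v y) + (of_real (v y) - f y)))\<^sup>2 \<partial>cell)"
    by simp
  also have "\<dots> \<le> 2 * (\<integral>y. (norm (complex_of_real (u y - v y)))\<^sup>2 \<partial>cell) + 2 * (\<integral>y. (norm (of_real (v y) - f y))\<^sup>2 \<partial>cell)"
    by (intro L2_integral_norm_add_le L2_diff L2_of_real trigpoly_L2 u v f)
  also have "(\<integral>y. (norm (complex_of_real (u y - v y)))\<^sup>2 \<partial>cell) = (\<integral>y. (u y - v y)\<^sup>2 \<partial>cell)"
    by (simp del: of_real_diff)
  also have "2 * (\<integral>y. (u y - v y)\<^sup>2 \<partial>cell) + 2 * (\<integral>y. (norm (of_real (v y) - f y))\<^sup>2 \<partial>cell) < \<epsilon>"
    using v f by simp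
  finally show "\<exists>f. trigpoly f \<and> (\<integral>y. (norm (of_real (u y) - f y))\<^sup>2 \<partial>cell) < \<epsilon>"
    using f(1) by blast
qed

lemma borel_measurable_cellI: "f \<in> borel_measurable borel \<Longrightarrow> f \<in> borel_measurable cell"
  by (intro measurable_restrict_space1 measurable_completion) simp

text \<open>Uniform approximation on the compact torus gives approximation in \<open>L\<^sup>2\<close>, the cell having finite
  measure.\<close>
lemma trig_approximable_continuous:
  fixes g :: "complex ^ 'n::finite \<Rightarrow> real"
  assumes g: "continuous_on UNIV g"
  shows "trig_approximable (\<lambda>y. g (torus y))"
  unfolding trig_approximable_def
proof (intro allI impI)
  fix \<epsilon> :: real assume e: "\<epsilon> > 0"
  define \<delta> where "\<delta> = sqrt (\<epsilon> / (2 * vol TYPE('n)))"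
  have "\<delta> > 0" using e vol_pos[where 'n = 'n] by (simp add: \<delta>_def)
  let ?K = "torus ` cbox 0 (\<chi> i. 2 * pi) :: (complex ^ 'n) set"
  have "compact ?K" by (intro compact_continuous_image continuous_torus compact_cbox)
  moreover have "continuous_on ?K g" using g continuous_on_subset by blast
  ultimately obtain p where p: "real_polynomial_function p" "\<And>z. z \<in> ?K \<Longrightarrow> \<bar>g z - p z\<bar> < \<delta>"
    using Stone_Weierstrass_real_polynomial_function \<open>\<delta> > 0\<close> by blast
  have "(\<integral>y. (norm (of_real (g (torus y)) - complex_of_real (p (torus y))))\<^sup>2 \<partial>cell)
    \<le> (\<integral>y. \<delta>\<^sup>2 \<partial>(cell :: (real ^ 'n) measure))"
  proof (rule integral_mono')
    show "integrable (cell :: (real ^ 'n) measure) (\<lambda>y. \<delta>\<^sup>2)"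
      using finite_measure_cell finite_measure.integrable_const by blast
    fix y :: "real ^ 'n" assume "y \<in> space cell"
    then have "torus y \<in> ?K" using Y_subset_cbox by (auto simp: space_restrict_space)
    then have "\<bar>g (torus y) - p (torus y)\<bar> \<le> \<delta>" using p(2) by fastforce
    then show "(norm (of_real (g (torus y)) - complex_of_real (p (torus y))))\<^sup>2 \<le> \<delta>\<^sup>2"
      by (metis abs_ge_zero norm_of_real of_real_diff power_mono)
  qed simp
  also have "\<dots> = \<epsilon> / 2"
    using e vol_pos[where 'n = 'n] by (simp only: integral_cell_const) (simp add: \<delta>_def)
  finally show "\<exists>f. trigpoly f \<and> (\<integral>y. (norm (of_real (g (torus y)) - f y))\<^sup>2 \<partial>cell) < \<epsilon>"
    using trigpoly_real_polynomial[OF p(1)] e by fastforce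
qed

text \<open>The functions \<open>max 0 (1 - k dist(z, torus ` C))\<close> are continuous on the torus and decrease to the
  indicator of the compact set \<open>torus ` C\<close>. Since \<open>torus\<close> is injective on the half-open cell,
  pulling back gives the indicator of \<open>C\<close>.\<close>
lemma trig_approximable_indicator_closed:
  fixes C :: "(real ^ 'n::finite) set"
  assumes C: "closed C" "C \<subseteq> Y"
  shows "trig_approximable (indicator C)"
proof (cases "C = {}")
  case True
  \<comment> \<open>The distance to the empty set is \<open>0\<close> by convention, so the functions used below do not fit.\<close>
  then show ?thesis using trig_approximable_continuous[of "\<lambda>_. 0"] by (simp add: indicator_def[abs_def])
next
  case False
  let ?K = "torus ` C"
  have "compact C" using C bounded_Y bounded_subset compact_eq_bounded_closed by blast
  then have K: "closed ?K" "?K \<noteq> {}"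
    using False by (auto intro: compact_imp_closed compact_continuous_image continuous_torus)
  define g where "g k z = max 0 (1 - real k * infdist z ?K)" for k and z :: "complex ^ 'n"
  have contg: "continuous_on UNIV (g k)" for k
    unfolding g_def by (intro continuous_intros)
  have g01: "0 \<le> g k z" "g k z \<le> 1" for k z
    by (auto simp: g_def infdist_nonneg)
  have meas: "(\<lambda>y. g k (torus y)) \<in> borel_measurable cell" for k
    by (intro borel_measurable_cellI borel_measurable_continuous_onI
        continuous_on_compose2[OF contg continuous_torus]) auto
  have mC: "(indicator C :: _ \<Rightarrow> real) \<in> borel_measurable cell"
    using C(1) by (intro borel_measurable_cellI) auto
  have lim: "(\<lambda>k. g k (torus y)) \<longlonglongrightarrow> indicator C y" if y: "y \<in> Y" for y
  proof (cases "y \<in> C")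
    case True
    then have "infdist (torus y) ?K = 0" by (simp add: infdist_zero)
    then show ?thesis using True by (simp add: g_def)
  next
    case False
    then have "torus y \<notin> ?K" using inj_on_torus y C(2) by (auto dest: inj_onD)
    then have pos: "infdist (torus y) ?K > 0"
      using K by (meson infdist_pos_not_in_closed)
    obtain N :: nat where N: "1 / infdist (torus y) ?K < real N" using reals_Archimedean2 by blast
    have "g k (torus y) = 0" if "k \<ge> N" for k
    proof -
      have "1 / infdist (torus y) ?K \<le> real k" using N that by linarith
      then show ?thesis using pos by (simp add: g_def field_simps)
    qed
    then have "\<forall>\<^sub>F k in sequentially. g k (torus y) = indicator C y"
      using False by (auto simp: eventually_sequentially)
    then show ?thesis by (rule tendsto_eventually)
  qed
  have "(\<lambda>k. \<integral>y. (indicator C y - g k (torus y))\<^sup>2 \<partial>cell) \<longlonglongrightarrow> (\<integral>y. 0 \<partial>(cell :: (real ^ 'n) measure))"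
  proof (rule integral_dominated_convergence[where w = "\<lambda>_. 1"])
    show "integrable (cell :: (real ^ 'n) measure) (\<lambda>_. 1 :: real)"
      using finite_measure_cell finite_measure.integrable_const by blast
    show "AE y in cell. (\<lambda>k. (indicator C y - g k (torus y))\<^sup>2) \<longlonglongrightarrow> 0"
    proof (rule AE_I2)
      fix y :: "real ^ 'n" assume "y \<in> space cell"
      then have "(\<lambda>k. (indicator C y - g k (torus y))\<^sup>2) \<longlonglongrightarrow> (indicator C y - indicator C y)\<^sup>2"
        by (intro tendsto_intros lim) (simp add: space_restrict_space)
      then show "(\<lambda>k. (indicator C y - g k (torus y))\<^sup>2) \<longlonglongrightarrow> 0" by simp
    qed
    show "AE y in cell. norm ((indicator C y - g k (torus y))\<^sup>2) \<le> 1" for k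
    proof (rule AE_I2)
      fix y
      have "\<bar>indicator C y - g k (torus y)\<bar> \<le> 1"
        using g01[of k "torus y"] by (auto simp: indicator_def)
      then show "norm ((indicator C y - g k (torus y))\<^sup>2) \<le> 1"
        by (simp add: abs_square_le_1)
    qed
  qed (use meas mC in measurable)
  then have lim0: "(\<lambda>k. \<integral>y. (indicator C y - g k (torus y))\<^sup>2 \<partial>cell) \<longlonglongrightarrow> 0" by simp
  show ?thesis
  proof (rule trig_approximable_closed)
    show "L2 cell (indicator C :: _ \<Rightarrow> real)"
      by (rule L2_bounded[OF finite_measure_cell mC, where C = 1]) (auto simp: indicator_def)
    fix \<epsilon> :: real assume "\<epsilon> > 0"
    then obtain k where "(\<integral>y. (indicator C y - g k (torus y))\<^sup>2 \<partial>cell) < \<epsilon>"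
      using order_tendstoD(2)[OF lim0] by (auto simp: eventually_sequentially)
    moreover have "L2 cell (\<lambda>y. g k (torus y))"
      by (rule L2_bounded[OF finite_measure_cell meas, where C = 1]) (use g01 in auto)
    ultimately show "\<exists>v. L2 cell v \<and> trig_approximable v \<and> (\<integral>y. (indicator C y - v y)\<^sup>2 \<partial>cell) < \<epsilon>"
      using trig_approximable_continuous[OF contg] by blast
  qed
qed

lemma trig_approximable_indicator:
  fixes S :: "(real ^ 'n::finite) set"
  assumes "S \<in> sets cell"
  shows "trig_approximable (indicator S)"
proof (rule trig_approximable_closed)
  have S: "S \<in> sets lebesgue" "S \<subseteq> Y"
    using assms by (auto simp: sets_restrict_space_iff)
  have L2: "L2 cell (indicator T :: _ \<Rightarrow> real)" if "T \<in> sets cell" for T :: "(real ^ 'n) set"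
    by (rule L2_bounded[OF finite_measure_cell, where C = 1]) (use that in \<open>auto simp: indicator_def\<close>)
  show "L2 cell (indicator S :: _ \<Rightarrow> real)" by (rule L2) fact
  fix \<epsilon> :: real assume e: "\<epsilon> > 0"
  obtain T where T: "closed T" "T \<subseteq> S" "S - T \<in> lmeasurable" "emeasure lebesgue (S - T) < ennreal \<epsilon>"
    using sets_lebesgue_inner_closed[OF S(1) e] by blast
  have Tc: "T \<in> sets cell" using T S by (auto simp: sets_restrict_space_iff borel_closed)
  have "measure lebesgue (S - T) < \<epsilon>"
    using T(3,4) e by (simp add: emeasure_eq_measure2 ennreal_less_iff)
  moreover have "(\<integral>y. (indicator S y - indicator T y)\<^sup>2 \<partial>cell) = measure lebesgue (S - T)"
  proof -
    have "(indicator S y - indicator T y)\<^sup>2 = (indicator (S - T) y :: real)" for y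
      using T(2) by (auto simp: indicator_def)
    then have "(\<integral>y. (indicator S y - indicator T y)\<^sup>2 \<partial>cell) = measure cell (S - T)"
      using assms Tc S by (simp add: Int_absorb2 subset_iff)
    also have "\<dots> = measure lebesgue (S - T)"
      using S by (intro measure_restrict_space) auto
    finally show ?thesis .
  qed
  ultimately show "\<exists>v. L2 cell v \<and> trig_approximable v \<and> (\<integral>y. (indicator S y - v y)\<^sup>2 \<partial>cell) < \<epsilon>"
    using L2[OF Tc] trig_approximable_indicator_closed[OF T(1) order_trans[OF T(2) S(2)]]
    by (intro exI[of _ "indicator T"] conjI) simp_all
qed

text \<open>The implication, instead of a further premise \<open>L2 cell u\<close>, lets square integrability pass through
  the induction: every function that occurs in it is dominated by a multiple of the next one.\<close>
lemma trig_approximable_nonneg: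
  fixes u :: "real ^ 'n::finite \<Rightarrow> real"
  assumes "u \<in> borel_measurable cell" "\<And>y. 0 \<le> u y"
  shows "L2 cell u \<longrightarrow> trig_approximable u"
  using assms
proof (induction rule: borel_measurable_induct_real)
  case (set S)
  show ?case by (intro impI trig_approximable_indicator set)
next
  case (mult u c)
  show ?case
  proof
    assume cu: "L2 cell (\<lambda>y. c * u y)"
    show "trig_approximable (\<lambda>y. c * u y)"
    proof (cases "c = 0")
      case True
      then show ?thesis using trig_approximable_continuous[of "\<lambda>_. 0"] by simp
    next
      case False
      then have "L2 cell u" using L2_scaleR[OF cu, of "1 / c"] by simp
      then show ?thesis using mult trig_approximable_cmult by blast
    qed
  qed
next
  case (add u v)
  show ?case
  proof
    assume "L2 cell (\<lambda>y. v y + u y)"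
    then have "L2 cell v" "L2 cell u"
      using add by (auto intro!: L2_dominated[of _ _ "\<lambda>y. v y + u y" 1])
    then show "trig_approximable (\<lambda>y. v y + u y)"
      using add by (auto intro: trig_approximable_add)
  qed
next
  case (seq U)
  show ?case
  proof
    assume u: "L2 cell u"
    have le: "U i y \<le> u y" if "y \<in> Y" for i y
    proof (rule incseq_le)
      show "incseq (\<lambda>i. U i y)" using \<open>incseq U\<close> by (auto simp: incseq_def le_fun_def)
      show "(\<lambda>i. U i y) \<longlonglongrightarrow> u y" using that by (intro seq.hyps(4)) (simp add: space_restrict_space)
    qed
    have UL2: "L2 cell (U i)" for i
    proof (rule L2_dominated[OF seq.hyps(1) u, where C = 1], rule AE_I2)
      fix y :: "real ^ 'n" assume "y \<in> space cell"
      then have "U i y \<le> u y" by (intro le) (simp add: space_restrict_space)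
      then show "norm (U i y) \<le> 1 * norm (u y)" using seq.hyps(2)[of i y] by simp
    qed
    have "(\<lambda>i. \<integral>y. (u y - U i y)\<^sup>2 \<partial>cell) \<longlonglongrightarrow> (\<integral>y. 0 \<partial>(cell :: (real ^ 'n) measure))"
    proof (rule integral_dominated_convergence[where w = "\<lambda>y. (norm (u y))\<^sup>2"])
      show "integrable cell (\<lambda>y. (norm (u y))\<^sup>2)" using u by (rule L2_integrable_square)
      show "AE y in cell. (\<lambda>i. (u y - U i y)\<^sup>2) \<longlonglongrightarrow> 0"
      proof (rule AE_I2)
        fix y :: "real ^ 'n" assume "y \<in> space cell"
        then have "(\<lambda>i. (u y - U i y)\<^sup>2) \<longlonglongrightarrow> (u y - u y)\<^sup>2"
          by (intro tendsto_intros seq.hyps(4))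
        then show "(\<lambda>i. (u y - U i y)\<^sup>2) \<longlonglongrightarrow> 0" by simp
      qed
      show "AE y in cell. norm ((u y - U i y)\<^sup>2) \<le> (norm (u y))\<^sup>2" for i
      proof (rule AE_I2)
        fix y :: "real ^ 'n" assume "y \<in> space cell"
        then have "U i y \<le> u y" by (intro le) (simp add: space_restrict_space)
        moreover have "0 \<le> U i y" by (rule seq.hyps(2))
        ultimately show "norm ((u y - U i y)\<^sup>2) \<le> (norm (u y))\<^sup>2" by (simp add: power_mono)
      qed
    qed (use u UL2 in measurable)
    then have lim: "(\<lambda>i. \<integral>y. (u y - U i y)\<^sup>2 \<partial>cell) \<longlonglongrightarrow> 0" by simp
    show "trig_approximable u"
    proof (rule trig_approximable_closed[OF u])
      fix \<epsilon> :: real assume "\<epsilon> > 0"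
      then obtain i where "(\<integral>y. (u y - U i y)\<^sup>2 \<partial>cell) < \<epsilon>"
        using order_tendstoD(2)[OF lim] by (auto simp: eventually_sequentially)
      then show "\<exists>v. L2 cell v \<and> trig_approximable v \<and> (\<integral>y. (u y - v y)\<^sup>2 \<partial>cell) < \<epsilon>"
        using UL2 seq.IH by blast
    qed
  qed
qed

theorem L2_trig_approximable:
  fixes u :: "real ^ 'n::finite \<Rightarrow> real"
  assumes u: "L2 cell u" shows "trig_approximable u"
proof -
  let ?p = "\<lambda>y. max 0 (u y)" and ?m = "\<lambda>y. max 0 (- u y)"
  have m [measurable]: "u \<in> borel_measurable cell" using u by (rule L2_measurable)
  have p: "L2 cell ?p" "L2 cell ?m"
    by (rule L2_dominated[OF _ u, of _ 1]; auto)+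
  then have "trig_approximable ?p" "trig_approximable ?m"
    using trig_approximable_nonneg[of ?p] trig_approximable_nonneg[of ?m] by simp_all
  then have "trig_approximable (\<lambda>y. ?p y + (-1) * ?m y)"
    using p L2_scaleR[OF p(2), of "-1"]
    by (intro trig_approximable_add trig_approximable_cmult) auto
  moreover have "(\<lambda>y. ?p y + (-1) * ?m y) = u" by (auto simp: max_def)
  ultimately show ?thesis by simp
qed

section \<open>Parseval's identity\<close>

definition fourier :: "(real ^ 'n::finite \<Rightarrow> real) \<Rightarrow> int ^ 'n \<Rightarrow> complex" where
  "fourier u n = (\<integral>y. of_real (u y) * cnj (wave n y) \<partial>cell)"

lemma integrable_mult_wave:
  assumes "L2 cell u"
  shows "integrable cell (\<lambda>y. of_real (u y) * wave n y)"
proof (rule Bochner_Integration.integrable_bound)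
  have "L2 cell (\<lambda>y. 1 :: real)" by (rule L2_bounded[OF finite_measure_cell, where C = 1]) auto
  then have "integrable cell (\<lambda>y. u y \<bullet> 1)" using assms L2_integrable_inner by blast
  then show "integrable cell u" by simp
  show "(\<lambda>y. of_real (u y) * wave n y) \<in> borel_measurable cell"
    using assms[THEN L2_measurable] by measurable
qed (simp add: norm_mult)

lemma integrable_mult_cnj_wave: "L2 cell u \<Longrightarrow> integrable cell (\<lambda>y. of_real (u y) * cnj (wave n y))"
  by (simp add: cnj_wave integrable_mult_wave)

lemma fourier_add: "L2 cell u \<Longrightarrow> L2 cell v \<Longrightarrow> fourier (\<lambda>y. u y + v y) n = fourier u n + fourier v n"
  by (simp add: fourier_def distrib_right integrable_mult_cnj_wave)

lemma fourier_diff: "L2 cell u \<Longrightarrow> L2 cell v \<Longrightarrow> fourier (\<lambda>y. u y - v y) n = fourier u n - fourier v n"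
  by (simp add: fourier_def left_diff_distrib integrable_mult_cnj_wave)

text \<open>Completing the square. The choice \<open>d n = fourier u n / V\<close> makes the last sum vanish and gives
  Bessel's inequality; for any other \<open>d\<close> that sum is nonnegative, so any approximation by a
  trigonometric polynomial bounds the defect in Bessel's inequality.\<close>
lemma integral_norm_diff_trigpoly:
  fixes u :: "real ^ 'n::finite \<Rightarrow> real"
  assumes u: "L2 cell u" and F: "finite F"
  defines "V \<equiv> vol TYPE('n)"
  shows "V * (\<integral>y. (norm (of_real (u y) - (\<Sum>n\<in>F. d n * wave n y)))\<^sup>2 \<partial>cell)
    = V * (\<integral>y. (u y)\<^sup>2 \<partial>cell) - (\<Sum>n\<in>F. (norm (fourier u n))\<^sup>2)
      + (\<Sum>n\<in>F. (norm (of_real V * d n - fourier u n))\<^sup>2)"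
proof -
  define S where "S y = (\<Sum>n\<in>F. d n * wave n y)" for y
  have 1: "complex_of_real ((norm (of_real (u y) - S y))\<^sup>2) = of_real ((u y)\<^sup>2)
     - (\<Sum>n\<in>F. cnj (d n) * (of_real (u y) * cnj (wave n y)))
     - (\<Sum>n\<in>F. d n * (of_real (u y) * wave n y))
     + (\<Sum>n\<in>F. \<Sum>m\<in>F. d n * cnj (d m) * (wave n y * cnj (wave m y)))" for y
  proof -
    have "complex_of_real ((norm (of_real (u y) - S y))\<^sup>2) = (of_real (u y) - S y) * cnj (of_real (u y) - S y)"
      by (rule complex_norm_square)
    also have "\<dots> = of_real ((u y)\<^sup>2) - of_real (u y) * cnj (S y) - S y * of_real (u y) + S y * cnj (S y)"
    proof -
      have "(a - b) * cnj (a - b) = a * cnj a - a * cnj b - b * cnj a + b * cnj b" for a b :: complex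
        by (simp add: algebra_simps)
      from this[of "of_real (u y)" "S y"] show ?thesis by (simp add: power2_eq_square)
    qed
    also have "of_real (u y) * cnj (S y) = (\<Sum>n\<in>F. cnj (d n) * (of_real (u y) * cnj (wave n y)))"
      unfolding S_def cnj_sum sum_distrib_left by (simp add: mult_ac)
    also have "S y * of_real (u y) = (\<Sum>n\<in>F. d n * (of_real (u y) * wave n y))"
      unfolding S_def sum_distrib_right by (simp add: mult_ac)
    also have "S y * cnj (S y) = (\<Sum>n\<in>F. \<Sum>m\<in>F. d n * cnj (d m) * (wave n y * cnj (wave m y)))"
      by (simp add: S_def sum_product mult_ac)
    finally show ?thesis .
  qed
  have iu2: "integrable cell (\<lambda>y. complex_of_real ((u y)\<^sup>2))"
    using L2_integrable_square[OF u] by (simp del: of_real_power)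
  have iww: "integrable cell (\<lambda>y. wave n y * cnj (wave m y))" for n m :: "int ^ 'n"
    by (intro finite_measure.integrable_const_bound[OF finite_measure_cell, of _ 1])
      (auto simp: norm_mult cnj_wave wave_mult)
  have cu: "(\<integral>y. of_real (u y) * wave n y \<partial>cell) = cnj (fourier u n)" for n
    unfolding fourier_def Bochner_Integration.integral_cnj[symmetric] by simp
  have "complex_of_real (\<integral>y. (norm (of_real (u y) - S y))\<^sup>2 \<partial>cell)
    = (\<integral>y. complex_of_real ((norm (of_real (u y) - S y))\<^sup>2) \<partial>cell)"
    by (rule integral_complex_of_real[symmetric])
  also have "\<dots> = of_real (\<integral>y. (u y)\<^sup>2 \<partial>cell) - (\<Sum>n\<in>F. cnj (d n) * fourier u n)
      - (\<Sum>n\<in>F. d n * cnj (fourier u n)) + (\<Sum>n\<in>F. \<Sum>m\<in>F. d n * cnj (d m) * (if n = m then of_real V else 0))"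
    unfolding 1 V_def
    using iu2 iww integrable_mult_wave[OF u] integrable_mult_cnj_wave[OF u]
    by (simp add: cu fourier_def[symmetric] integral_wave_cnj_wave del: of_real_power)
  also have "(\<Sum>n\<in>F. \<Sum>m\<in>F. d n * cnj (d m) * (if n = m then of_real V else 0)) = (\<Sum>n\<in>F. of_real V * (d n * cnj (d n)))"
    using F by (simp add: if_distrib[of "\<lambda>x. _ * x"] sum.delta mult_ac cong: if_cong)
  finally have 2: "complex_of_real (\<integral>y. (norm (of_real (u y) - S y))\<^sup>2 \<partial>cell)
    = of_real (\<integral>y. (u y)\<^sup>2 \<partial>cell) + (\<Sum>n\<in>F. of_real V * (d n * cnj (d n)) - cnj (d n) * fourier u n - d n * cnj (fourier u n))"
    unfolding sum_subtractf by (simp add: algebra_simps)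
  have 3: "of_real V * (of_real V * (d n * cnj (d n)) - cnj (d n) * fourier u n - d n * cnj (fourier u n))
    = complex_of_real ((norm (of_real V * d n - fourier u n))\<^sup>2 - (norm (fourier u n))\<^sup>2)" for n
    by (simp add: complex_norm_square algebra_simps del: of_real_power)
  have "complex_of_real (V * (\<integral>y. (norm (of_real (u y) - S y))\<^sup>2 \<partial>cell))
    = complex_of_real (V * (\<integral>y. (u y)\<^sup>2 \<partial>cell) +
       (\<Sum>n\<in>F. (norm (of_real V * d n - fourier u n))\<^sup>2 - (norm (fourier u n))\<^sup>2))"
    by (simp only: of_real_mult of_real_add 2 of_real_sum distrib_left sum_distrib_left 3)
  then have "V * (\<integral>y. (norm (of_real (u y) - S y))\<^sup>2 \<partial>cell)
    = V * (\<integral>y. (u y)\<^sup>2 \<partial>cell) + (\<Sum>n\<in>F. (norm (of_real V * d n - fourier u n))\<^sup>2 - (norm (fourier u n))\<^sup>2)"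
    using of_real_eq_iff by blast
  then show ?thesis by (simp add: S_def sum_subtractf)
qed

lemma Bessel:
  fixes u :: "real ^ 'n::finite \<Rightarrow> real"
  assumes u: "L2 cell u" and F: "finite F"
  shows "(\<Sum>n\<in>F. (norm (fourier u n))\<^sup>2) \<le> vol TYPE('n) * (\<integral>y. (u y)\<^sup>2 \<partial>cell)"
proof -
  have "0 \<le> vol TYPE('n) * (\<integral>y. (norm (of_real (u y) - (\<Sum>n\<in>F. fourier u n / of_real (vol TYPE('n)) * wave n y)))\<^sup>2 \<partial>cell)"
    by simp
  then show ?thesis
    using vol_pos[where 'n = 'n] by (subst (asm) integral_norm_diff_trigpoly[OF u F]) simp
qed

lemma Parseval_norm:
  fixes u :: "real ^ 'n::finite \<Rightarrow> real"
  assumes u: "L2 cell u"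
  shows "((\<lambda>n. (norm (fourier u n))\<^sup>2) has_sum vol TYPE('n) * (\<integral>y. (u y)\<^sup>2 \<partial>cell)) UNIV"
  unfolding has_sum_def tendsto_iff eventually_finite_subsets_at_top
proof (intro allI impI)
  fix \<epsilon> :: real assume e: "\<epsilon> > 0"
  let ?V = "vol TYPE('n)"
  obtain f where f: "trigpoly f" "(\<integral>y. (norm (of_real (u y) - f y))\<^sup>2 \<partial>cell) < \<epsilon> / ?V"
    using trig_approximableE[OF L2_trig_approximable[OF u] divide_pos_pos[OF e vol_pos]] by blast
  obtain F d where F: "finite F" and fF: "f = (\<lambda>y. \<Sum>n\<in>F. d n * wave n y)"
    using trigpoly_finite_sum[OF f(1)] .
  have "?V * (\<integral>y. (norm (of_real (u y) - f y))\<^sup>2 \<partial>cell) < \<epsilon>"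
    using f(2) vol_pos[where 'n = 'n] by (simp add: field_simps)
  moreover have "0 \<le> (\<Sum>n\<in>F. (norm (of_real ?V * d n - fourier u n))\<^sup>2)" by (simp add: sum_nonneg)
  ultimately have *: "?V * (\<integral>y. (u y)\<^sup>2 \<partial>cell) - (\<Sum>n\<in>F. (norm (fourier u n))\<^sup>2) < \<epsilon>"
    unfolding fF integral_norm_diff_trigpoly[OF u F] by linarith
  have "dist (\<Sum>n\<in>G. (norm (fourier u n))\<^sup>2) (?V * (\<integral>y. (u y)\<^sup>2 \<partial>cell)) < \<epsilon>" if "finite G" "F \<subseteq> G" for G
  proof -
    have "(\<Sum>n\<in>F. (norm (fourier u n))\<^sup>2) \<le> (\<Sum>n\<in>G. (norm (fourier u n))\<^sup>2)"
      using that by (intro sum_mono2) auto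
    then show ?thesis using * Bessel[OF u that(1)] by (simp add: dist_real_def)
  qed
  then show "\<exists>X. finite X \<and> X \<subseteq> UNIV \<and> (\<forall>Y. finite Y \<and> X \<subseteq> Y \<and> Y \<subseteq> UNIV \<longrightarrow>
      dist (\<Sum>n\<in>Y. (norm (fourier u n))\<^sup>2) (?V * (\<integral>y. (u y)\<^sup>2 \<partial>cell)) < \<epsilon>)"
    using F by blast
qed

lemma has_sum_diff:
  fixes f g :: "'a \<Rightarrow> real"
  assumes "(f has_sum a) A" "(g has_sum b) A"
  shows "((\<lambda>x. f x - g x) has_sum (a - b)) A"
  using has_sum_add[OF assms(1) has_sum_uminusI[OF assms(2)]] by simp

text \<open>Polarization. On complex numbers, \<open>a \<bullet> b\<close> is the real part of \<open>a\<close> times the conjugate of \<open>b\<close>; the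
  imaginary parts cancel between \<open>n\<close> and \<open>- n\<close> as \<open>u\<close> and \<open>v\<close> are real.\<close>
theorem Parseval:
  fixes u v :: "real ^ 'n::finite \<Rightarrow> real"
  assumes u: "L2 cell u" and v: "L2 cell v"
  shows "((\<lambda>n. fourier u n \<bullet> fourier v n) has_sum vol TYPE('n) * (\<integral>y. u y * v y \<partial>cell)) UNIV"
proof -
  have pol: "a \<bullet> b = 1/4 * ((norm (a + b))\<^sup>2 - (norm (a - b))\<^sup>2)" for a b :: complex
    unfolding power2_norm_eq_inner by (simp add: inner_add inner_diff inner_commute)
  have sq: "(\<integral>y. (u y + v y)\<^sup>2 \<partial>cell) = (\<integral>y. (u y)\<^sup>2 \<partial>cell) + (\<integral>y. (v y)\<^sup>2 \<partial>cell) + 2 * (\<integral>y. u y * v y \<partial>cell)"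
    "(\<integral>y. (u y - v y)\<^sup>2 \<partial>cell) = (\<integral>y. (u y)\<^sup>2 \<partial>cell) + (\<integral>y. (v y)\<^sup>2 \<partial>cell) - 2 * (\<integral>y. u y * v y \<partial>cell)"
    using L2_integrable_square[OF u] L2_integrable_square[OF v] L2_integrable_inner[OF u v]
    by (simp_all add: power2_sum power2_diff mult.assoc)
  have "((\<lambda>n. 1/4 * ((norm (fourier (\<lambda>y. u y + v y) n))\<^sup>2 - (norm (fourier (\<lambda>y. u y - v y) n))\<^sup>2)) has_sum
      1/4 * (vol TYPE('n) * (\<integral>y. (u y + v y)\<^sup>2 \<partial>cell) - vol TYPE('n) * (\<integral>y. (u y - v y)\<^sup>2 \<partial>cell))) UNIV"
    by (intro has_sum_cmult_right has_sum_diff Parseval_norm L2_add L2_diff u v)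
  then show ?thesis
    unfolding fourier_add[OF u v] fourier_diff[OF u v] pol[symmetric] sq by (simp add: algebra_simps)
qed

section \<open>Trigonometric test functions and weak gradients\<close>

text \<open>The phase \<open>c\<close> makes the family closed under differentiation, with sines included, and varying it
  recovers a complex identity from a family of real ones (\<open>Re_mult_cis_eq_0\<close>).\<close>
definition cosine :: "int ^ 'n \<Rightarrow> real \<Rightarrow> real \<Rightarrow> ('n::finite) scalar_field" where
  "cosine n a c y = a * cos (freq n \<bullet> y + c)"

lemma has_derivative_cosine:
  "(cosine n a c has_derivative (\<lambda>h. - a * sin (freq n \<bullet> y + c) * (freq n \<bullet> h))) (at y)"
proof -
  have "((\<lambda>y. freq n \<bullet> y + c) has_derivative (\<lambda>h. freq n \<bullet> h)) (at y)"
    by (auto intro!: derivative_eq_intros)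
  then have "((\<lambda>y. cos (freq n \<bullet> y + c)) has_derivative (\<lambda>h. - sin (freq n \<bullet> y + c) * (freq n \<bullet> h))) (at y)"
    by (rule has_derivative_eq_rhs[OF has_derivative_cos]) (simp add: mult.commute)
  then show ?thesis
    unfolding cosine_def[abs_def] mult.assoc
    by (rule has_derivative_eq_rhs[OF has_derivative_mult_right]) simp
qed

lemma pd_cosine: "pd i (cosine n a c) = cosine n (a * freq n $ i) (c + pi / 2)"
proof
  fix y
  have "pd i (cosine n a c) y = - a * sin (freq n \<bullet> y + c) * (freq n \<bullet> axis i 1)"
    unfolding pd_def using frechet_derivative_at[OF has_derivative_cosine[of n a c y]] by metis
  also have "\<dots> = cosine n (a * freq n $ i) (c + pi / 2) y"
    using minus_sin_cos_eq[of "freq n \<bullet> y + c", symmetric] by (simp add: cosine_def inner_axis add.assoc mult_ac)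
  finally show "pd i (cosine n a c) y = cosine n (a * freq n $ i) (c + pi / 2) y" .
qed

lemma foldr_pd_cosine: "\<exists>b d. foldr pd is (cosine n a c) = cosine n b d"
proof (induction "is")
  case Nil
  show ?case by auto
next
  case (Cons i "is")
  then obtain b d where "foldr pd is (cosine n a c) = cosine n b d" by blast
  then show ?case by (auto simp: pd_cosine)
qed

lemma cosine_smooth_periodic: "cosine n a c \<in> smooth_periodic"
proof -
  have "smooth (cosine n a c)"
    unfolding smooth_def using foldr_pd_cosine[of _ n a c] has_derivative_cosine
    by (metis differentiableI)
  moreover have "cosine n a c (y + lattice_shift p) = cosine n a c y" for p y
  proof -
    have "freq n \<bullet> lattice_shift p = (\<Sum>i\<in>UNIV. real_of_int (n $ i) * (2 * pi * real_of_int (p $ i)))"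
      by (simp add: inner_vec_def lattice_shift_def)
    also have "\<dots> = 2 * pi * real_of_int (\<Sum>i\<in>UNIV. n $ i * p $ i)"
      by (simp add: sum_distrib_left mult_ac)
    finally have shift: "freq n \<bullet> lattice_shift p = 2 * pi * real_of_int (\<Sum>i\<in>UNIV. n $ i * p $ i)" .
    have "\<exists>k :: int. (freq n \<bullet> y + c) + freq n \<bullet> lattice_shift p = (freq n \<bullet> y + c) + 2 * pi * real_of_int k"
      by (rule exI[of _ "\<Sum>i\<in>UNIV. n $ i * p $ i"]) (simp only: shift)
    then have "cos ((freq n \<bullet> y + c) + freq n \<bullet> lattice_shift p) = cos (freq n \<bullet> y + c)"
      unfolding sin_cos_eq_iff[symmetric] by (rule conjunct2)
    then show ?thesis by (simp add: cosine_def inner_add_right algebra_simps)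
  qed
  ultimately show ?thesis by (simp add: smooth_periodic_def)
qed

lemma laplacian_cosine: "laplacian (cosine n a c) = cosine n (- a * (norm (freq n))\<^sup>2) c"
proof
  fix y
  have "pd i (pd i (cosine n a c)) y = - (a * cos (freq n \<bullet> y + c)) * (freq n $ i)\<^sup>2" for i
  proof -
    have shift: "freq n \<bullet> y + (c + pi / 2 + pi / 2) = (freq n \<bullet> y + c) + pi"
      by (simp only: add.assoc field_sum_of_halves)
    have "cos (freq n \<bullet> y + (c + pi / 2 + pi / 2)) = - cos (freq n \<bullet> y + c)"
      unfolding shift by (rule cos_periodic_pi)
    then show ?thesis
      unfolding pd_cosine cosine_def power2_eq_square by (simp only:) (simp only: mult_ac mult_minus_left mult_minus_right)
  qed
  then have "laplacian (cosine n a c) y = - (a * cos (freq n \<bullet> y + c)) * (\<Sum>i\<in>UNIV. (freq n $ i)\<^sup>2)"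
    by (simp add: laplacian_def sum_distrib_left)
  also have "(\<Sum>i\<in>UNIV. (freq n $ i)\<^sup>2) = (norm (freq n))\<^sup>2"
    unfolding power2_norm_eq_inner by (simp add: inner_vec_def power2_eq_square)
  finally show "laplacian (cosine n a c) y = cosine n (- a * (norm (freq n))\<^sup>2) c y"
    unfolding cosine_def by (simp only: mult_ac mult_minus_left mult_minus_right)
qed

lemma cosine_wave: "cosine n a c y = a * Re (wave n y * cis c)"
  by (simp add: cosine_def wave_def cis_mult)

lemma integral_mult_cosine:
  assumes u: "L2 cell u"
  shows "integrable cell (\<lambda>y. u y * cosine n a c y)"
    and "(\<integral>y. u y * cosine n a c y \<partial>cell) = a * Re (cnj (fourier u n) * cis c)"
proof -
  have eq: "u y * cosine n a c y = a * Re (of_real (u y) * wave n y * cis c)" for y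
    by (simp add: cosine_wave algebra_simps)
  have int: "integrable cell (\<lambda>y. of_real (u y) * wave n y * cis c)"
    by (intro integrable_mult_left integrable_mult_wave u)
  show "integrable cell (\<lambda>y. u y * cosine n a c y)"
    unfolding eq by (intro integrable_mult_right integrable_Re int)
  have "(\<integral>y. u y * cosine n a c y \<partial>cell) = a * Re (\<integral>y. of_real (u y) * wave n y * cis c \<partial>cell)"
    unfolding eq integral_mult_right_zero integral_Re[OF int] ..
  also have "(\<integral>y. of_real (u y) * wave n y * cis c \<partial>cell) = (\<integral>y. of_real (u y) * wave n y \<partial>cell) * cis c"
    by (rule integral_mult_left_zero)
  also have "(\<integral>y. of_real (u y) * wave n y \<partial>cell) = cnj (fourier u n)"
    unfolding fourier_def Bochner_Integration.integral_cnj[symmetric] by simp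
  finally show "(\<integral>y. u y * cosine n a c y \<partial>cell) = a * Re (cnj (fourier u n) * cis c)" .
qed

lemma Re_mult_cis_eq_0:
  assumes "\<And>c. Re (z * cis c) = 0" shows "z = 0"
  using assms[of 0] assms[of "- (pi / 2)"] by (simp add: complex_eq_iff)

lemma fourier_weak_pd:
  assumes u: "L2 cell u" and v: "L2 cell v" and w: "has_weak_pd i u v"
  shows "fourier v n = \<i> * of_real (freq n $ i) * fourier u n"
proof -
  have "\<i> * of_real (freq n $ i) * cnj (fourier u n) + cnj (fourier v n) = 0"
  proof (rule Re_mult_cis_eq_0)
    fix c
    have "(\<integral>y. u y * pd i (cosine n 1 c) y \<partial>cell) = - (\<integral>y. v y * cosine n 1 c y \<partial>cell)"
      using w cosine_smooth_periodic unfolding has_weak_pd_def set_integral_cell by blast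
    then have "freq n $ i * Re (cnj (fourier u n) * cis (c + pi / 2)) = - Re (cnj (fourier v n) * cis c)"
      unfolding pd_cosine integral_mult_cosine(2)[OF u] integral_mult_cosine(2)[OF v] mult_1_left .
    moreover have "cis (c + pi / 2) = \<i> * cis c"
      by (simp add: mult.commute flip: cis_mult)
    ultimately show "Re ((\<i> * of_real (freq n $ i) * cnj (fourier u n) + cnj (fourier v n)) * cis c) = 0"
      by (simp add: algebra_simps)
  qed
  then have "cnj (\<i> * of_real (freq n $ i) * cnj (fourier u n) + cnj (fourier v n)) = 0" by simp
  then show ?thesis by (simp del: freq_nth add: algebra_simps)
qed

text \<open>The consequence of \<open>g\<close> being a weak gradient of \<open>u\<close> that is used from now on. It does not refer to
  the choice of a representative made by \<open>weak_grad\<close>, and it is preserved by differences.\<close>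
definition gradient_of :: "(real ^ 'n::finite \<Rightarrow> real) \<Rightarrow> (real ^ 'n \<Rightarrow> real ^ 'n) \<Rightarrow> bool" where
  "gradient_of u g \<longleftrightarrow> L2 cell u \<and> L2 cell g \<and>
     (\<forall>i n. fourier (\<lambda>y. g y $ i) n = \<i> * of_real (freq n $ i) * fourier u n)"

lemma gradient_of_diff:
  assumes "gradient_of u g" "gradient_of v h"
  shows "gradient_of (\<lambda>y. u y - v y) (\<lambda>y. g y - h y)"
  using assms unfolding gradient_of_def
  by (auto simp: L2_diff fourier_diff L2_component right_diff_distrib)

lemma H_per_subset_L2_per: "u \<in> H_per s \<Longrightarrow> u \<in> L2_per"
  by (cases s) auto

lemma gradient_of_weak_grad:
  assumes "u \<in> H_per (Suc s)" shows "gradient_of u (weak_grad u)"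
proof -
  have u: "L2 cell u" using assms L2_cellI by auto
  have wp: "L2 cell (weak_pd i u) \<and> has_weak_pd i u (weak_pd i u)" for i
  proof -
    obtain v where "v \<in> H_per s" "has_weak_pd i u v" using assms by auto
    then have "\<exists>v. v \<in> L2_per \<and> has_weak_pd i u v"
      using H_per_subset_L2_per by blast
    then have "weak_pd i u \<in> L2_per \<and> has_weak_pd i u (weak_pd i u)"
      unfolding weak_pd_def by (rule someI_ex)
    then show ?thesis using L2_cellI by blast
  qed
  have "L2 cell (weak_grad u)"
    unfolding weak_grad_def[abs_def] by (rule L2_vec_lambda) (use wp in blast)
  moreover have "fourier (\<lambda>y. weak_grad u y $ i) n = \<i> * of_real (freq n $ i) * fourier u n" for i n
    using fourier_weak_pd[OF u, of "weak_pd i u" i n] wp by (simp add: weak_grad_def)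
  ultimately show ?thesis using u by (simp add: gradient_of_def)
qed

lemma has_sum_sum:
  fixes f :: "'i \<Rightarrow> 'a \<Rightarrow> real"
  assumes "finite I" "\<And>i. i \<in> I \<Longrightarrow> (f i has_sum a i) S"
  shows "((\<lambda>x. \<Sum>i\<in>I. f i x) has_sum (\<Sum>i\<in>I. a i)) S"
  using assms by (induction I rule: finite_induct) (auto intro: has_sum_add)

lemma Parseval_vector:
  fixes f g :: "real ^ 'n::finite \<Rightarrow> real ^ 'n"
  assumes f: "L2 cell f" and g: "L2 cell g"
  shows "((\<lambda>n. \<Sum>i\<in>UNIV. fourier (\<lambda>y. f y $ i) n \<bullet> fourier (\<lambda>y. g y $ i) n) has_sum
    vol TYPE('n) * (\<integral>y. f y \<bullet> g y \<partial>cell)) UNIV"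
proof -
  have "(\<integral>y. f y \<bullet> g y \<partial>cell) = (\<Sum>i\<in>UNIV. \<integral>y. f y $ i * g y $ i \<partial>cell)"
    using L2_integrable_inner[OF L2_component[OF f] L2_component[OF g]]
    by (simp add: inner_vec_def)
  then have "vol TYPE('n) * (\<integral>y. f y \<bullet> g y \<partial>cell) = (\<Sum>i\<in>UNIV. vol TYPE('n) * (\<integral>y. f y $ i * g y $ i \<partial>cell))"
    by (simp only: sum_distrib_left)
  then show ?thesis
    by (simp only:) (intro has_sum_sum finite Parseval L2_component f g)
qed

lemma Parseval_vector_norm:
  fixes f :: "real ^ 'n::finite \<Rightarrow> real ^ 'n"
  assumes f: "L2 cell f"
  shows "((\<lambda>n. \<Sum>i\<in>UNIV. (norm (fourier (\<lambda>y. f y $ i) n))\<^sup>2) has_sum vol TYPE('n) * (L2_norm cell f)\<^sup>2) UNIV"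
  using Parseval_vector[OF f f] by (simp add: L2_norm_square power2_norm_eq_inner)

section \<open>Energy identity for correctors\<close>

locale elliptic_coefficient =
  fixes A :: "real ^ 'n::finite \<Rightarrow> real ^ 'n ^ 'n" and \<alpha> B :: real
  assumes entries: "\<And>k l. (\<lambda>y. A y $ k $ l) \<in> borel_measurable cell"
    and B: "0 \<le> B" "AE y in cell. \<forall>\<xi>. norm (A y *v \<xi>) \<le> B * norm \<xi>"
    and \<alpha>: "0 < \<alpha>" "AE y in cell. \<forall>\<xi>. \<alpha> * (norm \<xi>)\<^sup>2 \<le> (A y *v \<xi>) \<bullet> \<xi>"
begin

abbreviation "e j \<equiv> (\<lambda>y :: real ^ 'n. axis j 1 :: real ^ 'n)"

lemma L2_e: "L2 cell (e j)"
  by (rule L2_bounded[OF finite_measure_cell, where C = 1]) auto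

lemma L2_norm_e: "L2_norm cell (e j) = sqrt (vol TYPE('n))"
  unfolding L2_norm_def by (simp only: integral_cell_const) simp

lemma L2_flux: assumes g: "L2 cell g" shows "L2 cell (\<lambda>y. A y *v g y)"
proof (rule L2_dominated)
  show "AE y in cell. norm (A y *v g y) \<le> B * norm (g y)"
    using B(2) by eventually_elim blast
  show "(\<lambda>y. A y *v g y) \<in> borel_measurable cell"
    unfolding matrix_vector_mult_def
    by (intro measurable_vec_lambda borel_measurable_sum borel_measurable_times entries
        L2_measurable L2_component g)
qed fact

lemma L2_norm_flux_le: assumes g: "L2 cell g" shows "L2_norm cell (\<lambda>y. A y *v g y) \<le> B * L2_norm cell g"
  by (rule L2_norm_dominated[OF L2_flux[OF g] g])
    (use B in \<open>auto elim: eventually_mono\<close>)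

lemma flux_bound:
  assumes g: "L2 cell g" and h: "L2 cell h"
  shows "\<bar>\<integral>y. (A y *v g y) \<bullet> h y \<partial>cell\<bar> \<le> B * L2_norm cell g * L2_norm cell h"
  using L2_Cauchy_Schwarz[OF L2_flux[OF g] h] mult_right_mono[OF L2_norm_flux_le[OF g] L2_norm_nonneg[of cell h]]
  by simp

lemma flux_add:
  assumes "L2 cell f" "L2 cell g" "L2 cell h"
  shows "(\<integral>y. (A y *v (f y + g y)) \<bullet> h y \<partial>cell) = (\<integral>y. (A y *v f y) \<bullet> h y \<partial>cell) + (\<integral>y. (A y *v g y) \<bullet> h y \<partial>cell)"
  using assms by (simp add: matrix_vector_right_distrib inner_add_left L2_integrable_inner L2_flux)

lemma flux_diff:
  assumes "L2 cell f" "L2 cell g" "L2 cell h"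
  shows "(\<integral>y. (A y *v (f y - g y)) \<bullet> h y \<partial>cell) = (\<integral>y. (A y *v f y) \<bullet> h y \<partial>cell) - (\<integral>y. (A y *v g y) \<bullet> h y \<partial>cell)"
  using assms by (simp add: matrix_vector_mult_diff_distrib inner_diff_left L2_integrable_inner L2_flux)

lemma coercive:
  assumes g: "L2 cell g"
  shows "\<alpha> * (L2_norm cell g)\<^sup>2 \<le> (\<integral>y. (A y *v g y) \<bullet> g y \<partial>cell)"
proof -
  have "(\<integral>y. \<alpha> * (norm (g y))\<^sup>2 \<partial>cell) \<le> (\<integral>y. (A y *v g y) \<bullet> g y \<partial>cell)"
    by (rule integral_mono_AE)
      (use g \<alpha>(2) in \<open>auto simp: L2_integrable_square L2_integrable_inner L2_flux elim: eventually_mono\<close>)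
  then show ?thesis by (simp add: L2_norm_square)
qed

text \<open>The corrector equation in terms of Fourier coefficients, with \<open>g\<close> as the gradient of \<open>w\<close>.\<close>
definition corrector_gradient ::
  "real \<Rightarrow> 'n \<Rightarrow> (real ^ 'n \<Rightarrow> real) \<Rightarrow> (real ^ 'n \<Rightarrow> real ^ 'n) \<Rightarrow> bool" where
  "corrector_gradient r j w g \<longleftrightarrow> gradient_of w g \<and>
     (\<forall>n. of_real (r\<^sup>2 * norm (freq n) ^ 4) * fourier w n
        = (\<Sum>i\<in>UNIV. \<i> * of_real (freq n $ i) * fourier (\<lambda>y. (A y *v (e j y + g y)) $ i) n))"

text \<open>Test the equation with all \<open>cosine n 1 c\<close>: the bi-Laplacian multiplies by \<open>\<bar>n\<bar>\<^sup>4\<close>, and integrating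
  against the gradient produces the coefficients of the flux.\<close>
lemma corrector_gradient_weak_grad:
  assumes "is_corrector A r j w" "0 \<le> r"
  shows "corrector_gradient r j w (weak_grad w)"
proof -
  have H: "w \<in> H_per (if r > 0 then 2 else 1)"
    using assms(1) by (simp only: is_corrector_def)
  have "\<exists>s. w \<in> H_per (Suc s)"
  proof (cases "r > 0")
    case True
    then have "w \<in> H_per (Suc 1)" using H by (simp only: if_True Suc_1)
    then show ?thesis ..
  next
    case False
    then have "w \<in> H_per (Suc 0)" using H by (simp only: if_False One_nat_def)
    then show ?thesis ..
  qed
  then obtain s where "w \<in> H_per (Suc s)" ..
  then have g: "gradient_of w (weak_grad w)" by (rule gradient_of_weak_grad)
  then have w: "L2 cell w" and gL: "L2 cell (weak_grad w)" by (auto simp: gradient_of_def)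
  define F where "F y = A y *v (e j y + weak_grad w y)" for y
  have F: "L2 cell F" unfolding F_def by (intro L2_flux L2_add L2_e gL)
  have "of_real (r\<^sup>2 * norm (freq n) ^ 4) * fourier w n
      = (\<Sum>i\<in>UNIV. \<i> * of_real (freq n $ i) * fourier (\<lambda>y. F y $ i) n)" for n
  proof -
    have "of_real (r\<^sup>2 * norm (freq n) ^ 4) * cnj (fourier w n)
      + (\<Sum>i\<in>UNIV. \<i> * of_real (freq n $ i) * cnj (fourier (\<lambda>y. F y $ i) n)) = 0"
    proof (rule Re_mult_cis_eq_0)
      fix c
      have lap: "laplacian (laplacian (cosine n 1 c)) = cosine n (norm (freq n) ^ 4) c"
        by (simp add: laplacian_cosine power4_eq_xxxx power2_eq_square mult.assoc)
      have "(\<integral>y. F y \<bullet> grad (cosine n 1 c) y \<partial>cell)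
          = (\<integral>y. (\<Sum>i\<in>UNIV. F y $ i * cosine n (freq n $ i) (c + pi / 2) y) \<partial>cell)"
        by (simp add: inner_vec_def grad_def pd_cosine)
      also have "\<dots> = (\<Sum>i\<in>UNIV. freq n $ i * Re (cnj (fourier (\<lambda>y. F y $ i) n) * cis (c + pi / 2)))"
        by (subst Bochner_Integration.integral_sum)
          (simp_all only: integral_mult_cosine L2_component[OF F])
      finally have grd: "(\<integral>y. F y \<bullet> grad (cosine n 1 c) y \<partial>cell)
        = (\<Sum>i\<in>UNIV. freq n $ i * Re (cnj (fourier (\<lambda>y. F y $ i) n) * cis (c + pi / 2)))" .
      have "r\<^sup>2 * (\<integral>y. w y * laplacian (laplacian (cosine n 1 c)) y \<partial>cell)
          + (\<integral>y. F y \<bullet> grad (cosine n 1 c) y \<partial>cell) = 0"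
        using assms(1) cosine_smooth_periodic[of n 1 c]
        unfolding is_corrector_def set_integral_cell F_def by blast
      then have eq: "r\<^sup>2 * (norm (freq n) ^ 4 * Re (cnj (fourier w n) * cis c))
          + (\<Sum>i\<in>UNIV. freq n $ i * Re (cnj (fourier (\<lambda>y. F y $ i) n) * cis (c + pi / 2))) = 0"
        unfolding lap grd integral_mult_cosine(2)[OF w] .
      have "cis (c + pi / 2) = \<i> * cis c"
        by (simp add: mult.commute flip: cis_mult)
      then have "(\<Sum>i\<in>UNIV. freq n $ i * Re (cnj (fourier (\<lambda>y. F y $ i) n) * cis (c + pi / 2)))
          = Re ((\<Sum>i\<in>UNIV. \<i> * of_real (freq n $ i) * cnj (fourier (\<lambda>y. F y $ i) n)) * cis c)"
        unfolding sum_distrib_right Re_sum by (intro sum.cong refl) (simp add: algebra_simps)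
      moreover have "r\<^sup>2 * (norm (freq n) ^ 4 * Re (cnj (fourier w n) * cis c))
        = Re (of_real (r\<^sup>2 * norm (freq n) ^ 4) * cnj (fourier w n) * cis c)"
      proof -
        have "Re (of_real x * z) = x * Re z" for x z by simp
        then show ?thesis by (simp only: mult.assoc)
      qed
      ultimately show "Re ((of_real (r\<^sup>2 * norm (freq n) ^ 4) * cnj (fourier w n)
          + (\<Sum>i\<in>UNIV. \<i> * of_real (freq n $ i) * cnj (fourier (\<lambda>y. F y $ i) n))) * cis c) = 0"
        using eq by (simp only: distrib_right plus_complex.sel)
    qed
    then have "cnj (of_real (r\<^sup>2 * norm (freq n) ^ 4) * cnj (fourier w n)
      + (\<Sum>i\<in>UNIV. \<i> * of_real (freq n $ i) * cnj (fourier (\<lambda>y. F y $ i) n))) = 0" by simp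
    then have "of_real (r\<^sup>2 * norm (freq n) ^ 4) * fourier w n
      - (\<Sum>i\<in>UNIV. \<i> * of_real (freq n $ i) * fourier (\<lambda>y. F y $ i) n) = 0"
      by (simp add: sum_negf del: freq_nth)
    then show ?thesis by simp
  qed
  then show ?thesis using g unfolding corrector_gradient_def F_def by blast
qed

lemma flux_coefficients:
  assumes "corrector_gradient r j w g" "gradient_of z h"
  shows "r\<^sup>2 * norm (freq n) ^ 4 * (fourier w n \<bullet> fourier z n)
    = - (\<Sum>i\<in>UNIV. fourier (\<lambda>y. (A y *v (e j y + g y)) $ i) n \<bullet> fourier (\<lambda>y. h y $ i) n)"
proof -
  let ?F = "\<lambda>i. fourier (\<lambda>y. (A y *v (e j y + g y)) $ i) n"
  have "r\<^sup>2 * norm (freq n) ^ 4 * (fourier w n \<bullet> fourier z n)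
      = (of_real (r\<^sup>2 * norm (freq n) ^ 4) * fourier w n) \<bullet> fourier z n"
    by (simp only: scaleR_conv_of_real[symmetric] inner_scaleR_left)
  also have "\<dots> = (\<Sum>i\<in>UNIV. (\<i> * of_real (freq n $ i) * ?F i) \<bullet> fourier z n)"
    using assms(1) by (simp add: corrector_gradient_def inner_sum_left)
  also have "\<dots> = (\<Sum>i\<in>UNIV. - (?F i \<bullet> (\<i> * of_real (freq n $ i) * fourier z n)))"
    by (intro sum.cong refl) (simp add: inner_complex_def algebra_simps)
  finally show ?thesis
    using assms(2) by (simp add: gradient_of_def sum_negf)
qed

text \<open>The equation tested with \<open>z\<close>. The left-hand side would be \<open>r\<^sup>2 \<bar>Y\<bar> \<integral> \<Delta>w \<Delta>z\<close> if both Laplacians were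
  square integrable; here the series converges because it equals a Parseval series of the
  flux and of the gradient \<open>h\<close>, so \<open>z\<close> may be any function in \<open>H\<^sup>1\<close>, such as a corrector for \<open>r = 0\<close>.\<close>
lemma energy_identity:
  assumes w: "corrector_gradient r j w g" and z: "gradient_of z h"
  shows "((\<lambda>n. r\<^sup>2 * norm (freq n) ^ 4 * (fourier w n \<bullet> fourier z n)) has_sum
    - (vol TYPE('n) * (\<integral>y. (A y *v (e j y + g y)) \<bullet> h y \<partial>cell))) UNIV"
proof -
  have "L2 cell g" "L2 cell h" using w z by (auto simp: corrector_gradient_def gradient_of_def)
  then show ?thesis
    unfolding flux_coefficients[OF w z]
    by (intro has_sum_uminusI Parseval_vector L2_flux L2_add L2_e)
qed

end

context elliptic_coefficient
begin

lemma corrector_gradientD: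
  assumes "corrector_gradient r j w g"
  shows "gradient_of w g" "L2 cell w" "L2 cell g" "L2 cell (\<lambda>y. e j y + g y)"
  using assms L2_add[OF L2_e] by (auto simp: corrector_gradient_def gradient_of_def)

section \<open>Convergence of the corrector gradients\<close>

text \<open>The energy identity for \<open>z = w\<close>, with the quadratic part of the right-hand side estimated by
  ellipticity and the linear part by the Cauchy-Schwarz inequality.\<close>
lemma energy_bound:
  assumes "corrector_gradient r j w g"
  shows "((\<lambda>n. r\<^sup>2 * norm (freq n) ^ 4 * (norm (fourier w n))\<^sup>2) has_sum
      - (vol TYPE('n) * (\<integral>y. (A y *v (e j y + g y)) \<bullet> g y \<partial>cell))) UNIV"
    and "- (\<integral>y. (A y *v (e j y + g y)) \<bullet> g y \<partial>cell)
      \<le> B * sqrt (vol TYPE('n)) * L2_norm cell g - \<alpha> * (L2_norm cell g)\<^sup>2"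
proof -
  note g = corrector_gradientD[OF assms]
  show "((\<lambda>n. r\<^sup>2 * norm (freq n) ^ 4 * (norm (fourier w n))\<^sup>2) has_sum
      - (vol TYPE('n) * (\<integral>y. (A y *v (e j y + g y)) \<bullet> g y \<partial>cell))) UNIV"
    unfolding power2_norm_eq_inner[of "fourier w _"] by (rule energy_identity[OF assms g(1)])
  have "\<bar>\<integral>y. (A y *v e j y) \<bullet> g y \<partial>cell\<bar> \<le> B * sqrt (vol TYPE('n)) * L2_norm cell g"
    using flux_bound[OF L2_e[of j] g(3)] by (simp only: L2_norm_e)
  then show "- (\<integral>y. (A y *v (e j y + g y)) \<bullet> g y \<partial>cell)
      \<le> B * sqrt (vol TYPE('n)) * L2_norm cell g - \<alpha> * (L2_norm cell g)\<^sup>2"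
    using coercive[OF g(3)] unfolding flux_add[OF L2_e g(3) g(3)] by linarith
qed

lemma corrector_gradient_bounded:
  assumes g: "corrector_gradient r j w g"
  shows "\<alpha> * L2_norm cell g \<le> B * sqrt (vol TYPE('n))"
proof -
  have "0 \<le> - (vol TYPE('n) * (\<integral>y. (A y *v (e j y + g y)) \<bullet> g y \<partial>cell))"
    by (rule has_sum_nonneg[OF energy_bound(1)[OF g]]) simp
  then have "(\<integral>y. (A y *v (e j y + g y)) \<bullet> g y \<partial>cell) \<le> 0"
    using vol_pos[where 'n = 'n] by (simp add: mult_le_0_iff)
  then have "\<alpha> * L2_norm cell g * L2_norm cell g \<le> B * sqrt (vol TYPE('n)) * L2_norm cell g"
    using energy_bound(2)[OF g] vol_pos[where 'n = 'n]
    by (simp add: power2_eq_square mult.assoc)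
  then show ?thesis
  proof (cases "L2_norm cell g = 0")
    case False
    then have "0 < L2_norm cell g" using L2_norm_nonneg[of cell g] by simp
    then show ?thesis
      using \<open>\<alpha> * L2_norm cell g * L2_norm cell g \<le> B * sqrt (vol TYPE('n)) * L2_norm cell g\<close>
      by (rule mult_right_le_imp_le[rotated])
  qed (use B(1) in simp)
qed

text \<open>A nonzero integer vector has norm at least \<open>1\<close>. In terms of functions this is the Poincare
  inequality that bounds the gradient by the Laplacian.\<close>
lemma norm_freq_power: "(norm (freq n))\<^sup>2 \<le> norm (freq n) ^ 4" for n :: "int ^ 'n"
proof -
  define m where "m = (\<Sum>i\<in>UNIV. n $ i * n $ i)"
  have "(norm (freq n))\<^sup>2 = real_of_int m"
    unfolding power2_norm_eq_inner by (simp add: inner_vec_def m_def)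
  moreover have "0 \<le> m" unfolding m_def by (intro sum_nonneg) simp
  moreover from this have "m \<le> m * m" by (cases "m = 0") (auto simp: mult_le_cancel_left1)
  ultimately have "(norm (freq n))\<^sup>2 \<le> ((norm (freq n))\<^sup>2)\<^sup>2"
    by (metis of_int_le_iff of_int_mult power2_eq_square)
  then show ?thesis by (simp flip: power_mult)
qed

text \<open>The energy \<open>\<Sum>\<^sub>n r\<^sup>2 \<bar>n\<bar>\<^sup>4 \<bar>w\<^sup>^(n)\<bar>\<^sup>2\<close> dominates \<open>r\<^sup>2 \<bar>Y\<bar> \<parallel>\<nabla>w\<parallel>\<^sup>2\<close> by the previous lemma, but grows at most
  linearly in \<open>\<parallel>\<nabla>w\<parallel>\<close>.\<close>
lemma corrector_gradient_decay:
  assumes g: "corrector_gradient r j w g" and r: "r > 0"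
  shows "L2_norm cell g \<le> B * sqrt (vol TYPE('n)) / r\<^sup>2"
proof (cases "L2_norm cell g = 0")
  case True
  then show ?thesis using B(1) by simp
next
  case False
  then have pos: "0 < L2_norm cell g" using L2_norm_nonneg[of cell g] by simp
  have gr: "gradient_of w g" by (rule corrector_gradientD[OF g])
  have coef: "(\<Sum>i\<in>UNIV. (norm (fourier (\<lambda>y. g y $ i) n))\<^sup>2) = (norm (freq n))\<^sup>2 * (norm (fourier w n))\<^sup>2" for n
  proof -
    have "(\<Sum>i\<in>UNIV. (norm (fourier (\<lambda>y. g y $ i) n))\<^sup>2) = (\<Sum>i\<in>UNIV. (freq n $ i)\<^sup>2 * (norm (fourier w n))\<^sup>2)"
      using gr unfolding gradient_of_def by (simp add: norm_mult power_mult_distrib)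
    also have "\<dots> = (\<Sum>i\<in>UNIV. (freq n $ i)\<^sup>2) * (norm (fourier w n))\<^sup>2"
      by (rule sum_distrib_right[symmetric])
    also have "(\<Sum>i\<in>UNIV. (freq n $ i)\<^sup>2) = (norm (freq n))\<^sup>2"
      unfolding power2_norm_eq_inner by (simp add: inner_vec_def power2_eq_square)
    finally show ?thesis .
  qed
  have "((\<lambda>n. r\<^sup>2 * ((norm (freq n))\<^sup>2 * (norm (fourier w n))\<^sup>2)) has_sum r\<^sup>2 * (vol TYPE('n) * (L2_norm cell g)\<^sup>2)) UNIV"
    using Parseval_vector_norm[OF corrector_gradientD(3)[OF g]] unfolding coef by (rule has_sum_cmult_right)
  then have "r\<^sup>2 * (vol TYPE('n) * (L2_norm cell g)\<^sup>2) \<le> - (vol TYPE('n) * (\<integral>y. (A y *v (e j y + g y)) \<bullet> g y \<partial>cell))"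
  proof (rule has_sum_mono[OF _ energy_bound(1)[OF g]])
    fix n :: "int ^ 'n"
    show "r\<^sup>2 * ((norm (freq n))\<^sup>2 * (norm (fourier w n))\<^sup>2) \<le> r\<^sup>2 * norm (freq n) ^ 4 * (norm (fourier w n))\<^sup>2"
      unfolding mult.assoc by (intro mult_left_mono mult_right_mono norm_freq_power) simp_all
  qed
  then have "vol TYPE('n) * (r\<^sup>2 * (L2_norm cell g)\<^sup>2) \<le> vol TYPE('n) * (- (\<integral>y. (A y *v (e j y + g y)) \<bullet> g y \<partial>cell))"
    by (simp only: mult_ac mult_minus_right)
  then have "r\<^sup>2 * (L2_norm cell g)\<^sup>2 \<le> - (\<integral>y. (A y *v (e j y + g y)) \<bullet> g y \<partial>cell)"
    using vol_pos[where 'n = 'n] by (rule mult_left_le_imp_le)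
  also have "\<dots> \<le> B * sqrt (vol TYPE('n)) * L2_norm cell g"
    using energy_bound(2)[OF g] \<alpha>(1) zero_le_power2[of "L2_norm cell g"] by (smt (verit) mult_nonneg_nonneg)
  finally have "(r\<^sup>2 * L2_norm cell g) * L2_norm cell g \<le> (B * sqrt (vol TYPE('n))) * L2_norm cell g"
    by (simp only: power2_eq_square mult.assoc)
  then have "r\<^sup>2 * L2_norm cell g \<le> B * sqrt (vol TYPE('n))"
    using pos by (rule mult_right_le_imp_le)
  then show ?thesis using r by (simp add: pos_le_divide_eq mult.commute)
qed

text \<open>Scaling the identity for \<open>t\<close> by \<open>r\<^sup>2/t\<^sup>2\<close> makes the fourth-order parts of the two identities match, so
  that their difference is a fourth-order energy of \<open>w - v\<close>, which is nonnegative. What remains of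
  the right-hand sides is \<open>- \<integral> A \<nabla>(w - v) \<bullet> \<nabla>(w - v)\<close> and a multiple of \<open>r\<^sup>2/t\<^sup>2 - 1\<close>.\<close>
lemma corrector_gradient_Lipschitz:
  assumes g: "corrector_gradient r j w g" and h: "corrector_gradient t j v h" and t: "t > 0"
  shows "\<alpha> * L2_norm cell (\<lambda>y. g y - h y) \<le> \<bar>r\<^sup>2 / t\<^sup>2 - 1\<bar> * (B * L2_norm cell (\<lambda>y. e j y + h y))"
proof -
  note gD = corrector_gradientD[OF g] and hD = corrector_gradientD[OF h]
  let ?u = "\<lambda>y. w y - v y" and ?z = "\<lambda>y. g y - h y" and ?q = "r\<^sup>2 / t\<^sup>2"
  have z: "gradient_of ?u ?z" by (rule gradient_of_diff[OF gD(1) hD(1)])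
  then have zL: "L2 cell ?z" by (simp add: gradient_of_def)
  define I where "I = (\<integral>y. (A y *v (e j y + h y)) \<bullet> (g y - h y) \<partial>cell)"
  define J where "J = (\<integral>y. (A y *v (g y - h y)) \<bullet> (g y - h y) \<partial>cell)"
  have IJ: "(\<integral>y. (A y *v (e j y + g y)) \<bullet> (g y - h y) \<partial>cell) = I + J"
    unfolding I_def J_def
    by (subst flux_add[OF hD(4) zL zL, symmetric]) (simp add: algebra_simps)
  have "((\<lambda>n. r\<^sup>2 * norm (freq n) ^ 4 * (fourier w n \<bullet> fourier ?u n)
      - ?q * (t\<^sup>2 * norm (freq n) ^ 4 * (fourier v n \<bullet> fourier ?u n)))
    has_sum (- (vol TYPE('n) * (I + J)) - ?q * (- (vol TYPE('n) * I)))) UNIV"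
    unfolding IJ[symmetric] unfolding I_def
    by (intro has_sum_diff has_sum_cmult_right energy_identity[OF g z] energy_identity[OF h z])
  then have "0 \<le> - (vol TYPE('n) * (I + J)) - ?q * (- (vol TYPE('n) * I))"
  proof (rule has_sum_nonneg)
    fix n :: "int ^ 'n"
    have "?q * (t\<^sup>2 * norm (freq n) ^ 4 * (fourier v n \<bullet> fourier ?u n))
      = r\<^sup>2 * norm (freq n) ^ 4 * (fourier v n \<bullet> fourier ?u n)"
      using t by simp
    moreover have "r\<^sup>2 * norm (freq n) ^ 4 * (fourier w n \<bullet> fourier ?u n) - r\<^sup>2 * norm (freq n) ^ 4 * (fourier v n \<bullet> fourier ?u n)
      = r\<^sup>2 * norm (freq n) ^ 4 * (fourier ?u n \<bullet> fourier ?u n)"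
      unfolding right_diff_distrib[symmetric] inner_diff_left[symmetric] by (simp only: fourier_diff[OF gD(2) hD(2)])
    ultimately show "0 \<le> r\<^sup>2 * norm (freq n) ^ 4 * (fourier w n \<bullet> fourier ?u n)
      - ?q * (t\<^sup>2 * norm (freq n) ^ 4 * (fourier v n \<bullet> fourier ?u n))"
      by simp
  qed
  then have "0 \<le> vol TYPE('n) * ((?q - 1) * I - J)"
    by (simp add: algebra_simps)
  then have "J \<le> (?q - 1) * I"
    using vol_pos[where 'n = 'n] by (simp add: zero_le_mult_iff)
  also have "\<dots> \<le> \<bar>?q - 1\<bar> * \<bar>I\<bar>"
    by (metis abs_ge_self abs_mult)
  also have "\<dots> \<le> \<bar>?q - 1\<bar> * (B * L2_norm cell (\<lambda>y. e j y + h y) * L2_norm cell ?z)"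
    unfolding I_def by (intro mult_left_mono flux_bound hD zL) simp
  finally have "J \<le> \<bar>?q - 1\<bar> * (B * L2_norm cell (\<lambda>y. e j y + h y) * L2_norm cell ?z)" .
  then have le: "(\<alpha> * L2_norm cell ?z) * L2_norm cell ?z \<le> (\<bar>?q - 1\<bar> * (B * L2_norm cell (\<lambda>y. e j y + h y))) * L2_norm cell ?z"
    using coercive[OF zL] unfolding J_def[symmetric] by (simp only: power2_eq_square mult.assoc)
  show ?thesis
  proof (cases "L2_norm cell ?z = 0")
    case True
    then show ?thesis using B(1) L2_norm_nonneg[of cell "\<lambda>y. e j y + h y"] by simp
  next
    case False
    then have "0 < L2_norm cell ?z" using L2_norm_nonneg[of cell ?z] by simp
    with le show ?thesis by (rule mult_right_le_imp_le)
  qed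
qed

lemma L2_norm_flux_uniform:
  assumes g: "corrector_gradient r j w g"
  shows "(L2_norm cell (\<lambda>y. A y *v (e j y + g y)))\<^sup>2
    \<le> B\<^sup>2 * (2 * vol TYPE('n) + 2 * (B * sqrt (vol TYPE('n)) / \<alpha>)\<^sup>2)"
proof -
  note gD = corrector_gradientD[OF g]
  have "(L2_norm cell (\<lambda>y. A y *v (e j y + g y)))\<^sup>2 \<le> (B * L2_norm cell (\<lambda>y. e j y + g y))\<^sup>2"
    by (intro power_mono L2_norm_flux_le gD L2_norm_nonneg)
  also have "\<dots> = B\<^sup>2 * (L2_norm cell (\<lambda>y. e j y + g y))\<^sup>2" by (rule power_mult_distrib)
  also have "\<dots> \<le> B\<^sup>2 * (2 * (L2_norm cell (e j))\<^sup>2 + 2 * (L2_norm cell g)\<^sup>2)"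
    unfolding L2_norm_square by (intro mult_left_mono L2_integral_norm_add_le L2_e gD) simp
  also have "\<dots> \<le> B\<^sup>2 * (2 * vol TYPE('n) + 2 * (B * sqrt (vol TYPE('n)) / \<alpha>)\<^sup>2)"
  proof -
    have "(L2_norm cell (e j))\<^sup>2 = vol TYPE('n)"
      unfolding L2_norm_e using vol_pos[where 'n = 'n] by simp
    moreover have "(L2_norm cell g)\<^sup>2 \<le> (B * sqrt (vol TYPE('n)) / \<alpha>)\<^sup>2"
    proof (rule power_mono)
      show "L2_norm cell g \<le> B * sqrt (vol TYPE('n)) / \<alpha>"
        using corrector_gradient_bounded[OF g] \<alpha>(1) by (simp add: pos_le_divide_eq mult.commute)
    qed (rule L2_norm_nonneg)
    ultimately show ?thesis by (intro mult_left_mono add_mono) simp_all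
  qed
  finally show ?thesis .
qed

text \<open>With \<open>a = w\<^sup>^(n)\<close> and \<open>b = v\<^sup>^(n)\<close>, the difference of the identities for \<open>r\<close> and for \<open>0\<close> expresses
  \<open>\<bar>Y\<bar> \<integral> A \<nabla>(w - v) \<bullet> \<nabla>(w - v)\<close> as the sum over \<open>n\<close> of \<open>- r\<^sup>2 \<bar>n\<bar>\<^sup>4 a \<bullet> (a - b)\<close>. Each term is bounded in one
  of two ways. On \<open>S\<close>, completing the square gives \<open>r\<^sup>2 \<bar>n\<bar>\<^sup>4 \<bar>b\<bar>\<^sup>2\<close>. Off \<open>S\<close>, the term is at most
  \<open>r\<^sup>2 \<bar>n\<bar>\<^sup>4 a \<bullet> b\<close>; this may not be estimated by coefficients of \<open>v\<close> alone, which need not be square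
  summable with weight \<open>\<bar>n\<bar>\<^sup>4\<close>, but by the equation for \<open>w\<close> it is minus an inner product of
  coefficients of the flux and of \<open>\<nabla>v\<close>, to which Young's inequality with weight \<open>D\<close> applies.\<close>
lemma corrector_gradient_defect:
  assumes g: "corrector_gradient r j w g" and h: "corrector_gradient 0 j v h"
    and D: "D > 0" and S: "finite S"
  shows "vol TYPE('n) * \<alpha> * (L2_norm cell (\<lambda>y. g y - h y))\<^sup>2
    \<le> r\<^sup>2 * (\<Sum>n\<in>S. norm (freq n) ^ 4 * (norm (fourier v n))\<^sup>2)
      + D / 2 * (vol TYPE('n) * (L2_norm cell (\<lambda>y. A y *v (e j y + g y)))\<^sup>2)
      + 1 / (2 * D) * (vol TYPE('n) * (L2_norm cell h)\<^sup>2 - (\<Sum>n\<in>S. \<Sum>i\<in>UNIV. (norm (fourier (\<lambda>y. h y $ i) n))\<^sup>2))"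
proof -
  note gD = corrector_gradientD[OF g] and hD = corrector_gradientD[OF h]
  let ?F = "\<lambda>i n. fourier (\<lambda>y. (A y *v (e j y + g y)) $ i) n" and ?H = "\<lambda>i n. fourier (\<lambda>y. h y $ i) n"
  let ?u = "\<lambda>y. w y - v y" and ?z = "\<lambda>y. g y - h y"
  define \<Phi> where "\<Phi> n = (\<Sum>i\<in>UNIV. (norm (?F i n))\<^sup>2)" for n
  define \<Gamma> where "\<Gamma> n = (\<Sum>i\<in>UNIV. (norm (?H i n))\<^sup>2)" for n
  define c where "c n = norm (freq n) ^ 4 * (norm (fourier v n))\<^sup>2" for n
  have z: "gradient_of ?u ?z" by (rule gradient_of_diff[OF gD(1) hD(1)])
  then have zL: "L2 cell ?z" by (simp add: gradient_of_def)
  define I where "I = (\<integral>y. (A y *v (e j y + h y)) \<bullet> (g y - h y) \<partial>cell)"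
  define J where "J = (\<integral>y. (A y *v (g y - h y)) \<bullet> (g y - h y) \<partial>cell)"
  have IJ: "(\<integral>y. (A y *v (e j y + g y)) \<bullet> (g y - h y) \<partial>cell) = I + J"
    unfolding I_def J_def
    by (subst flux_add[OF hD(4) zL zL, symmetric]) (simp add: algebra_simps)
  have "((\<lambda>n. 0\<^sup>2 * norm (freq n) ^ 4 * (fourier v n \<bullet> fourier ?u n)) has_sum - (vol TYPE('n) * I)) UNIV"
    unfolding I_def by (rule energy_identity[OF h z])
  then have "((\<lambda>n :: int ^ 'n. 0 :: real) has_sum - (vol TYPE('n) * I)) UNIV" by simp
  then have "- (vol TYPE('n) * I) = 0" using has_sum_0_simp has_sum_unique by blast
  then have I0: "I = 0" using vol_pos[where 'n = 'n] by simp
  have fin: "((\<lambda>n. if n \<in> S then f n else 0) has_sum sum f S) UNIV" for f :: "int ^ 'n \<Rightarrow> real"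
    by (rule has_sum_finite_neutralI[OF S]) auto
  have sum\<Phi>: "(\<Phi> has_sum vol TYPE('n) * (L2_norm cell (\<lambda>y. A y *v (e j y + g y)))\<^sup>2) UNIV"
    unfolding \<Phi>_def[abs_def] by (intro Parseval_vector_norm L2_flux gD)
  have sum\<Gamma>: "(\<Gamma> has_sum vol TYPE('n) * (L2_norm cell h)\<^sup>2) UNIV"
    unfolding \<Gamma>_def[abs_def] by (intro Parseval_vector_norm hD)
  have "((\<lambda>n. - (r\<^sup>2 * norm (freq n) ^ 4 * (fourier w n \<bullet> fourier ?u n))) has_sum - (- (vol TYPE('n) * J))) UNIV"
    using has_sum_uminusI[OF energy_identity[OF g z]] unfolding IJ I0 by simp
  moreover have "((\<lambda>n. r\<^sup>2 * (if n \<in> S then c n else 0) + D / 2 * \<Phi> n + 1 / (2 * D) * (\<Gamma> n - (if n \<in> S then \<Gamma> n else 0)))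
    has_sum r\<^sup>2 * sum c S + D / 2 * (vol TYPE('n) * (L2_norm cell (\<lambda>y. A y *v (e j y + g y)))\<^sup>2)
      + 1 / (2 * D) * (vol TYPE('n) * (L2_norm cell h)\<^sup>2 - sum \<Gamma> S)) UNIV"
    by (intro has_sum_add has_sum_cmult_right has_sum_diff fin sum\<Phi> sum\<Gamma>)
  ultimately have "- (- (vol TYPE('n) * J)) \<le> r\<^sup>2 * sum c S + D / 2 * (vol TYPE('n) * (L2_norm cell (\<lambda>y. A y *v (e j y + g y)))\<^sup>2)
      + 1 / (2 * D) * (vol TYPE('n) * (L2_norm cell h)\<^sup>2 - sum \<Gamma> S)"
  proof (rule has_sum_mono)
    fix n :: "int ^ 'n"
    let ?a = "fourier w n" and ?b = "fourier v n" and ?m = "r\<^sup>2 * norm (freq n) ^ 4"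
    have m: "0 \<le> ?m" by simp
    have ab: "fourier ?u n = ?a - ?b" by (rule fourier_diff[OF gD(2) hD(2)])
    have \<Phi>\<Gamma>: "0 \<le> \<Phi> n" "0 \<le> \<Gamma> n" by (simp_all add: \<Phi>_def \<Gamma>_def sum_nonneg)
    show "- (?m * (?a \<bullet> fourier ?u n))
      \<le> r\<^sup>2 * (if n \<in> S then c n else 0) + D / 2 * \<Phi> n + 1 / (2 * D) * (\<Gamma> n - (if n \<in> S then \<Gamma> n else 0))"
    proof (cases "n \<in> S")
      case True
      have "0 \<le> (norm (?a - (1/2) *\<^sub>R ?b))\<^sup>2" by simp
      also have "\<dots> = ?a \<bullet> ?a - ?a \<bullet> ?b + 1/4 * (norm ?b)\<^sup>2"
        unfolding power2_norm_eq_inner by (simp add: inner_diff inner_commute field_simps)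
      finally have "- (?a \<bullet> (?a - ?b)) \<le> (norm ?b)\<^sup>2"
        unfolding inner_diff_right using zero_le_power2[of "norm ?b"] by linarith
      then have "?m * (- (?a \<bullet> (?a - ?b))) \<le> ?m * (norm ?b)\<^sup>2" using m by (rule mult_left_mono)
      also have "\<dots> = r\<^sup>2 * c n" by (simp only: c_def mult.assoc)
      finally have "- (?m * (?a \<bullet> (?a - ?b))) \<le> r\<^sup>2 * c n" by (simp only: mult_minus_right)
      moreover have "0 \<le> D / 2 * \<Phi> n" using D \<Phi>\<Gamma>(1) by simp
      ultimately show ?thesis unfolding ab using True by simp
    next
      case False
      have "?m * (?a \<bullet> ?b) = (\<Sum>i\<in>UNIV. - (?F i n \<bullet> ?H i n))"
        unfolding flux_coefficients[OF g hD(1)] by (simp only: sum_negf)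
      also have "\<dots> \<le> (\<Sum>i\<in>UNIV. D / 2 * (norm (?F i n))\<^sup>2 + 1 / (2 * D) * (norm (?H i n))\<^sup>2)"
      proof (rule sum_mono)
        fix i
        let ?x = "?F i n" and ?y = "?H i n"
        have "0 \<le> 1 / (2 * D) * (norm (D *\<^sub>R ?x + ?y))\<^sup>2" using D by simp
        also have "\<dots> = D / 2 * (norm ?x)\<^sup>2 + ?x \<bullet> ?y + 1 / (2 * D) * (norm ?y)\<^sup>2"
          unfolding power2_norm_eq_inner using D
          by (simp add: inner_add inner_commute field_simps power2_eq_square)
        finally show "- (?x \<bullet> ?y) \<le> D / 2 * (norm ?x)\<^sup>2 + 1 / (2 * D) * (norm ?y)\<^sup>2" by linarith
      qed
      also have "\<dots> = D / 2 * \<Phi> n + 1 / (2 * D) * \<Gamma> n"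
        unfolding \<Phi>_def \<Gamma>_def sum.distrib sum_distrib_left ..
      finally have "?m * (?a \<bullet> ?b) \<le> D / 2 * \<Phi> n + 1 / (2 * D) * \<Gamma> n" .
      moreover have "0 \<le> ?m * (?a \<bullet> ?a)" by simp
      ultimately have "- (?m * (?a \<bullet> ?a) - ?m * (?a \<bullet> ?b)) \<le> D / 2 * \<Phi> n + 1 / (2 * D) * \<Gamma> n"
        by linarith
      then show ?thesis
        unfolding ab inner_diff_right using False
        by (simp only: if_False mult_zero_right diff_zero add_0_left right_diff_distrib)
    qed
  qed
  moreover have "vol TYPE('n) * (\<alpha> * (L2_norm cell ?z)\<^sup>2) \<le> vol TYPE('n) * J"
    unfolding J_def by (intro mult_left_mono coercive zL) simp
  ultimately show ?thesis
    unfolding c_def \<Gamma>_def by (simp add: mult.assoc)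
qed

text \<open>In \<open>corrector_gradient_defect\<close>, first choose \<open>D\<close> so that the flux term is small uniformly in \<open>r\<close>,
  then \<open>S\<close> so that the tail divided by \<open>2 D\<close> is small, and only then \<open>r\<close>.\<close>
lemma corrector_gradient_continuous_at_0:
  assumes h: "corrector_gradient 0 j v h" and \<epsilon>: "\<epsilon> > 0"
  shows "\<exists>\<delta>>0. \<forall>r w g. 0 < r \<longrightarrow> r < \<delta> \<longrightarrow> corrector_gradient r j w g \<longrightarrow> L2_norm cell (\<lambda>y. g y - h y) < \<epsilon>"
proof -
  define K where "K = B\<^sup>2 * (2 * vol TYPE('n) + 2 * (B * sqrt (vol TYPE('n)) / \<alpha>)\<^sup>2)"
  \<comment> \<open>A quarter of the total budget; the three error terms use at most three quarters of it.\<close>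
  define \<eta> where "\<eta> = vol TYPE('n) * \<alpha> * \<epsilon>\<^sup>2 / 4"
  \<comment> \<open>The summand \<open>1\<close> avoids a division by zero.\<close>
  define D where "D = \<eta> / (vol TYPE('n) * K + 1)"
  have V: "0 < vol TYPE('n)" by (rule vol_pos)
  have K: "0 \<le> K" using V by (simp add: K_def)
  have \<eta>: "0 < \<eta>" using V \<alpha>(1) \<epsilon> by (simp add: \<eta>_def)
  have VK: "0 < vol TYPE('n) * K + 1" using V K by (simp add: add_nonneg_pos)
  have D: "0 < D" using \<eta> VK by (simp add: D_def)
  have "D * (vol TYPE('n) * K + 1) = \<eta>" using VK by (simp add: D_def)
  then have DK: "D / 2 * (vol TYPE('n) * K) \<le> \<eta>"
    using D \<eta> mult_nonneg_nonneg[of D "vol TYPE('n) * K"] V K by (simp add: algebra_simps)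
  let ?\<Gamma> = "\<lambda>n. \<Sum>i\<in>UNIV. (norm (fourier (\<lambda>y. h y $ i) n))\<^sup>2"
  have "(?\<Gamma> has_sum vol TYPE('n) * (L2_norm cell h)\<^sup>2) UNIV"
    by (rule Parseval_vector_norm[OF corrector_gradientD(3)[OF h]])
  moreover have "0 < 2 * D * \<eta>" using D \<eta> by simp
  ultimately obtain S where S: "finite S"
    and "dist (sum ?\<Gamma> S) (vol TYPE('n) * (L2_norm cell h)\<^sup>2) \<le> 2 * D * \<eta>"
    using has_sum_finite_approximation by blast
  then have "vol TYPE('n) * (L2_norm cell h)\<^sup>2 - sum ?\<Gamma> S \<le> 2 * D * \<eta>"
    by (simp add: dist_real_def)
  then have tail: "1 / (2 * D) * (vol TYPE('n) * (L2_norm cell h)\<^sup>2 - sum ?\<Gamma> S) \<le> \<eta>"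
    using D by (simp add: field_simps)
  define C where "C = (\<Sum>n\<in>S. norm (freq n) ^ 4 * (norm (fourier v n))\<^sup>2)"
  have C: "0 \<le> C" unfolding C_def by (intro sum_nonneg) simp
  define \<delta> where "\<delta> = sqrt (\<eta> / (C + 1))"
  have \<delta>: "0 < \<delta>" using \<eta> C by (simp add: \<delta>_def)
  have "L2_norm cell (\<lambda>y. g y - h y) < \<epsilon>" if r: "0 < r" "r < \<delta>" and g: "corrector_gradient r j w g" for r w g
  proof -
    have "r\<^sup>2 \<le> \<delta>\<^sup>2" using r by (intro power_mono) auto
    also have "\<delta>\<^sup>2 = \<eta> / (C + 1)" using \<eta> C by (simp add: \<delta>_def)
    finally have "r\<^sup>2 * (C + 1) \<le> \<eta>" using C by (simp add: field_simps)
    then have rC: "r\<^sup>2 * C \<le> \<eta>"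
      unfolding distrib_left using zero_le_power2[of r] by linarith
    have "D / 2 * (vol TYPE('n) * (L2_norm cell (\<lambda>y. A y *v (e j y + g y)))\<^sup>2) \<le> D / 2 * (vol TYPE('n) * K)"
      unfolding K_def using D V by (intro mult_left_mono L2_norm_flux_uniform[OF g]) auto
    then have "vol TYPE('n) * \<alpha> * (L2_norm cell (\<lambda>y. g y - h y))\<^sup>2 \<le> \<eta> + \<eta> + \<eta>"
      using corrector_gradient_defect[OF g h D S] rC DK tail unfolding C_def by linarith
    also have "\<dots> < 4 * \<eta>" using \<eta> by simp
    also have "4 * \<eta> = vol TYPE('n) * \<alpha> * \<epsilon>\<^sup>2" by (simp add: \<eta>_def)
    finally have "(L2_norm cell (\<lambda>y. g y - h y))\<^sup>2 < \<epsilon>\<^sup>2"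
      using V \<alpha>(1) by (simp add: mult_less_cancel_left_pos)
    then show ?thesis by (rule power2_less_imp_less) (use \<epsilon> in simp)
  qed
  then show ?thesis using \<delta> by blast
qed

section \<open>Homogenized matrices\<close>

lemma hom_matrix_entry:
  assumes "L2 cell (weak_grad (w l))"
  shows "hom_matrix A w $ k $ l = mean_matrix A $ k $ l
    + (\<integral>y. (A y *v weak_grad (w l) y) \<bullet> e k y \<partial>cell) / vol TYPE('n)"
proof -
  have "(\<integral>y. e k y \<bullet> (A y *v e l y) + e k y \<bullet> (A y *v weak_grad (w l) y) \<partial>cell)
    = (\<integral>y. (A y *v e l y) \<bullet> e k y \<partial>cell) + (\<integral>y. (A y *v weak_grad (w l) y) \<bullet> e k y \<partial>cell)"
    using L2_integrable_inner[OF L2_flux[OF L2_e[of l]] L2_e[of k]] L2_integrable_inner[OF L2_flux[OF assms] L2_e[of k]]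
    by (simp add: inner_commute)
  moreover have "(A y *v e l y) \<bullet> e k y = A y $ k $ l" for y
    by (simp add: matrix_vector_mult_basis inner_axis column_def)
  ultimately show ?thesis
    by (simp add: hom_matrix_def mean_matrix_def mean_Y_cell add_divide_distrib)
qed

lemma tendsto_flux:
  assumes g: "\<And>x. L2 cell (g x)" and h: "L2 cell h"
    and lim: "((\<lambda>x. L2_norm cell (\<lambda>y. g x y - h y)) \<longlongrightarrow> 0) F"
  shows "((\<lambda>x. \<integral>y. (A y *v g x y) \<bullet> e k y \<partial>cell) \<longlongrightarrow> (\<integral>y. (A y *v h y) \<bullet> e k y \<partial>cell)) F"
proof (rule LIM_zero_cancel, rule Lim_null_comparison)
  show "\<forall>\<^sub>F x in F. norm ((\<integral>y. (A y *v g x y) \<bullet> e k y \<partial>cell) - (\<integral>y. (A y *v h y) \<bullet> e k y \<partial>cell))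
    \<le> B * L2_norm cell (\<lambda>y. g x y - h y) * sqrt (vol TYPE('n))"
  proof (rule always_eventually, rule allI)
    fix x
    show "norm ((\<integral>y. (A y *v g x y) \<bullet> e k y \<partial>cell) - (\<integral>y. (A y *v h y) \<bullet> e k y \<partial>cell))
      \<le> B * L2_norm cell (\<lambda>y. g x y - h y) * sqrt (vol TYPE('n))"
      using flux_bound[OF L2_diff[OF g h] L2_e[of k], of x]
      unfolding flux_diff[OF g h L2_e] L2_norm_e real_norm_def .
  qed
  show "((\<lambda>x. B * L2_norm cell (\<lambda>y. g x y - h y) * sqrt (vol TYPE('n))) \<longlongrightarrow> 0) F"
    by (intro tendsto_mult_left_zero tendsto_mult_right_zero lim)
qed

end

lemma admissible_coeff_elliptic:
  fixes A :: "real ^ 'n::finite \<Rightarrow> real ^ 'n ^ 'n"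
  assumes "admissible_coeff A"
  obtains \<alpha> B where "elliptic_coefficient A \<alpha> B"
proof -
  obtain C where C: "AE y in lebesgue. \<forall>k l. \<bar>A y $ k $ l\<bar> \<le> C"
    using assms unfolding admissible_coeff_def by blast
  obtain \<alpha> where \<alpha>: "\<alpha> > 0" "AE y in lebesgue. \<forall>\<xi>. (A y *v \<xi>) \<bullet> \<xi> \<ge> \<alpha> * (norm \<xi>)\<^sup>2"
    using assms unfolding admissible_coeff_def elliptic_def by blast
  define B where "B = real CARD('n) * real CARD('n) * \<bar>C\<bar>"
  have "elliptic_coefficient A \<alpha> B"
  proof
    show "(\<lambda>y. A y $ k $ l) \<in> borel_measurable cell" for k l
      using assms unfolding admissible_coeff_def by (intro measurable_restrict_space1) blast
    show "0 \<le> B" by (simp add: B_def)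
    have "AE y in lebesgue. \<forall>\<xi>. norm (A y *v \<xi>) \<le> B * norm \<xi>"
      using C
    proof eventually_elim
      fix y assume y: "\<forall>k l. \<bar>A y $ k $ l\<bar> \<le> C"
      have "onorm ((*v) (A y)) \<le> B"
        unfolding B_def using y by (intro onorm_le_matrix_component) (meson abs_ge_self order_trans)
      then show "\<forall>\<xi>. norm (A y *v \<xi>) \<le> B * norm \<xi>"
        using onorm[OF matrix_vector_mul_bounded_linear[of "A y"]]
        by (meson mult_right_mono norm_ge_zero order_trans)
    qed
    then show "AE y in cell. \<forall>\<xi>. norm (A y *v \<xi>) \<le> B * norm \<xi>" by (rule AE_cell)
    show "AE y in cell. \<forall>\<xi>. \<alpha> * (norm \<xi>)\<^sup>2 \<le> (A y *v \<xi>) \<bullet> \<xi>"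
      using \<alpha>(2) by (rule AE_cell)
  qed (rule \<alpha>(1))
  then show ?thesis by (rule that)
qed

theorem theorem6p3:
  fixes A :: "real ^ ('n::finite) \<Rightarrow> real ^ 'n ^ 'n"
    and X :: "real \<Rightarrow> 'n \<Rightarrow> real ^ 'n \<Rightarrow> real"
    and \<theta> :: ereal
    and \<rho> :: "'i \<Rightarrow> real" and F :: "'i filter"
  assumes "admissible_coeff A"
    and "\<And>r j. 0 \<le> r \<Longrightarrow> is_corrector A r j (X r j)"
    and "0 \<le> \<theta>"
    and "eventually (\<lambda>x. 0 < \<rho> x) F"
    and "((\<lambda>x. ereal (\<rho> x)) \<longlongrightarrow> \<theta>) F"
  shows "((\<lambda>x. hom_matrix A (X (\<rho> x))) \<longlongrightarrow> A_hom A X \<theta>) F"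
proof -
  obtain \<alpha> B where "elliptic_coefficient A \<alpha> B"
    using assms(1) by (rule admissible_coeff_elliptic)
  then interpret elliptic_coefficient A \<alpha> B .
  define G where "G r j = weak_grad (X r j)" for r j
  have G: "corrector_gradient r j (X r j) (G r j)" if "0 \<le> r" for r j
    unfolding G_def using assms(2) that by (intro corrector_gradient_weak_grad) auto
  \<comment> \<open>The correctors are given for nonnegative parameters, whereas \<open>\<rho>\<close> is positive only eventually;
    truncation makes every corrector in the limit available.\<close>
  define \<sigma> where "\<sigma> x = max 0 (\<rho> x)" for x
  have \<sigma>: "0 \<le> \<sigma> x" for x by (simp add: \<sigma>_def)
  have \<sigma>_eq: "\<forall>\<^sub>F x in F. \<sigma> x = \<rho> x \<and> 0 < \<rho> x"
    using assms(4) by eventually_elim (simp add: \<sigma>_def)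
  have GL: "L2 cell (G (\<sigma> x) j)" for x j by (rule corrector_gradientD(3)[OF G[OF \<sigma>]])
  have "((\<lambda>x. hom_matrix A (X (\<sigma> x))) \<longlongrightarrow> A_hom A X \<theta>) F"
  proof (intro vec_tendstoI)
    fix k l
    have entry: "hom_matrix A (X r) $ k $ l = mean_matrix A $ k $ l
        + (\<integral>y. (A y *v G r l y) \<bullet> e k y \<partial>cell) / vol TYPE('n)" if "0 \<le> r" for r
      using corrector_gradientD(3)[OF G[OF that, of l]] unfolding G_def by (rule hom_matrix_entry)
    have lim: "((\<lambda>x. hom_matrix A (X (\<sigma> x)) $ k $ l) \<longlongrightarrow> mean_matrix A $ k $ l
        + (\<integral>y. (A y *v h y) \<bullet> e k y \<partial>cell) / vol TYPE('n)) F"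
      if "L2 cell h" "((\<lambda>x. L2_norm cell (\<lambda>y. G (\<sigma> x) l y - h y)) \<longlongrightarrow> 0) F" for h
      unfolding entry[OF \<sigma>] using vol_pos[where 'n = 'n]
      by (intro tendsto_intros tendsto_flux GL that) simp
    show "((\<lambda>x. hom_matrix A (X (\<sigma> x)) $ k $ l) \<longlongrightarrow> A_hom A X \<theta> $ k $ l) F"
    proof (cases "\<theta> = \<infinity>")
      case True
      then have top: "filterlim \<rho> at_top F" using assms(5) by (simp add: tendsto_PInfty_eq_at_top)
      have "((\<lambda>x. B * sqrt (vol TYPE('n)) / (\<rho> x)\<^sup>2) \<longlongrightarrow> 0) F"
        by (rule real_tendsto_divide_at_top[OF tendsto_const filterlim_pow_at_top[OF _ top]]) simp
      then have "((\<lambda>x. L2_norm cell (G (\<sigma> x) l)) \<longlongrightarrow> 0) F"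
      proof (rule Lim_null_comparison[rotated])
        show "\<forall>\<^sub>F x in F. norm (L2_norm cell (G (\<sigma> x) l)) \<le> B * sqrt (vol TYPE('n)) / (\<rho> x)\<^sup>2"
          using \<sigma>_eq
        proof eventually_elim
          case (elim x)
          then show ?case
            using corrector_gradient_decay[OF G[of "\<rho> x" l]] L2_norm_nonneg[of cell "G (\<rho> x) l"] by simp
        qed
      qed
      moreover have "L2 cell (\<lambda>y. 0 :: real ^ 'n)" by (simp add: L2_def)
      ultimately show ?thesis using lim[of "\<lambda>y. 0"] True by (simp add: A_hom_def)
    next
      case False
      then obtain t where t: "\<theta> = ereal t" "0 \<le> t" using assms(3) by (cases \<theta>) auto
      then have \<rho>: "(\<rho> \<longlongrightarrow> t) F" using assms(5) by simp
      have "((\<lambda>x. L2_norm cell (\<lambda>y. G (\<sigma> x) l y - G t l y)) \<longlongrightarrow> 0) F"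
      proof (cases "t = 0")
        case True
        show ?thesis
        proof (rule tendstoI)
          fix \<epsilon> :: real assume "\<epsilon> > 0"
          then obtain \<delta> where \<delta>: "\<delta> > 0" and close: "\<And>r w g. 0 < r \<Longrightarrow> r < \<delta> \<Longrightarrow> corrector_gradient r l w g
              \<Longrightarrow> L2_norm cell (\<lambda>y. g y - G 0 l y) < \<epsilon>"
            using corrector_gradient_continuous_at_0[OF G[OF order_refl, of l]] by blast
          have "\<forall>\<^sub>F x in F. \<rho> x < \<delta>" using \<rho> \<delta> True by (intro order_tendstoD(2)) auto
          with \<sigma>_eq show "\<forall>\<^sub>F x in F. dist (L2_norm cell (\<lambda>y. G (\<sigma> x) l y - G t l y)) 0 < \<epsilon>"
          proof eventually_elim
            case (elim x)
            then show ?case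
              using close[OF _ _ G[of "\<rho> x" l]] L2_norm_nonneg[of cell "\<lambda>y. G (\<rho> x) l y - G 0 l y"] True
              by (simp add: dist_real_def)
          qed
        qed
      next
        case False
        with t(2) have tpos: "0 < t" by simp
        let ?c = "B * L2_norm cell (\<lambda>y. e l y + G t l y) / \<alpha>"
        have "((\<lambda>x. \<bar>(\<rho> x)\<^sup>2 / t\<^sup>2 - 1\<bar> * ?c) \<longlongrightarrow> \<bar>t\<^sup>2 / t\<^sup>2 - 1\<bar> * ?c) F"
          by (intro tendsto_intros \<rho>) (use tpos in auto)
        then have "((\<lambda>x. \<bar>(\<rho> x)\<^sup>2 / t\<^sup>2 - 1\<bar> * ?c) \<longlongrightarrow> 0) F" using tpos by simp
        then show ?thesis
        proof (rule Lim_null_comparison[rotated])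
          show "\<forall>\<^sub>F x in F. norm (L2_norm cell (\<lambda>y. G (\<sigma> x) l y - G t l y)) \<le> \<bar>(\<rho> x)\<^sup>2 / t\<^sup>2 - 1\<bar> * ?c"
            using \<sigma>_eq
          proof eventually_elim
            case (elim x)
            then have x: "0 \<le> \<rho> x" "\<sigma> x = \<rho> x" by simp_all
            have "\<alpha> * L2_norm cell (\<lambda>y. G (\<rho> x) l y - G t l y)
                \<le> \<bar>(\<rho> x)\<^sup>2 / t\<^sup>2 - 1\<bar> * (B * L2_norm cell (\<lambda>y. e l y + G t l y))"
              by (rule corrector_gradient_Lipschitz[OF G[OF x(1)] G[OF t(2)] tpos])
            then show ?case
              using \<alpha>(1) L2_norm_nonneg[of cell "\<lambda>y. G (\<rho> x) l y - G t l y"]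
              unfolding x(2) by (simp add: pos_le_divide_eq mult.commute)
          qed
        qed
      qed
      then show ?thesis
        using lim[OF corrector_gradientD(3)[OF G[OF t(2)]]] entry[OF t(2)] t(1)
        by (simp add: A_hom_def)
    qed
  qed
  then show ?thesis
    by (rule Lim_transform_eventually) (use \<sigma>_eq in eventually_elim, simp)
qed

end
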